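(* Let $\alpha\in\mathbb{R}\setminus\mathbb{Q}$, let $v(x)=\sum_{1\le|j|\le M}\lambda_je^{2\pi ijx}$ with $\lambda_{-j}=\overline{\lambda_j}$, and let $c(x)=\sum_{k=N_1}^{N_2}\mu_ke^{2\pi ikx}$ with $N_1<N_2$, $\mu_{N_1}\mu_{N_2}\ne0$. Assume $N_2-N_1>2M$. Then for every $E\in\mathbb{R}$ there is $\epsilon_0\ge0$ such that $$L(\alpha,A^E_\epsilon)=\pi(N_2-N_1)|\epsilon|+\tfrac12\big(\log|\mu_{N_1}|+\log|\mu_{N_2}|\big)\quad\text{for all }|\epsilon|\ge\epsilon_0.$$ In particular $L(0;E)\ge\frac12(\log|\mu_{N_1}|+\log|\mu_{N_2}|)-I(c)$.
   Context: The Jacobi operator on $\ell^2(\mathbb{Z})$ is $(H\psi)_n=\overline{c(x+(n-1)\alpha)}\psi_{n-1}+c(x+n\alpha)\psi_{n+1}+v(x+n\alpha)\psi_n$. Let $\tilde c(z):=\sum_{k=N_1}^{N_2}\overline{\mu_k}e^{-2\pi ikz}$. The phase-complexified Jacobi cocycle is $(\alpha,A^E_\epsilon)$ with $A^E_\epsilon(x)=\begin{pmatrix}E-v(x+i\epsilon)&-\tilde c(x+i\epsilon-\alpha)\\ c(x+i\epsilon)&0\end{pmatrix}$; $L(\alpha,A^E_\epsilon)=\lim_n\frac1n\int_{\mathbb{R}/\mathbb{Z}}\log\|A^E_\epsilon(x+(n-1)\alpha)\cdots A^E_\epsilon(x)\|dx$. $I(c)=\int_{\mathbb{R}/\mathbb{Z}}\log|c(x)|dx$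 and $L(\epsilon;E)=L(\alpha,A^E_\epsilon)-I(c)$. *)

theory Defs
  imports "HOL-Analysis.Analysis"
begin

definition trig_v :: "nat \<Rightarrow> (int \<Rightarrow> complex) \<Rightarrow> complex \<Rightarrow> complex" where
  "trig_v M lam z = (\<Sum>j\<in>{-int M..int M} - {0}. lam j * exp (2 * pi * \<i> * of_int j * z))"

definition trig_c :: "int \<Rightarrow> int \<Rightarrow> (int \<Rightarrow> complex) \<Rightarrow> complex \<Rightarrow> complex" where
  "trig_c N1 N2 mu z = (\<Sum>k=N1..N2. mu k * exp (2 * pi * \<i> * of_int k * z))"

definition trig_ct :: "int \<Rightarrow> int \<Rightarrow> (int \<Rightarrow> complex) \<Rightarrow> complex \<Rightarrow> complex" where
  "trig_ct N1 N2 mu z = (\<Sum>k=N1..N2. cnj (mu k) * exp (- (2 * pi * \<i> * of_int k * z)))"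

definition mat2 :: "complex \<Rightarrow> complex \<Rightarrow> complex \<Rightarrow> complex \<Rightarrow> complex^2^2" where
  "mat2 a b c d = (\<chi> i. if i = 1 then (\<chi> j. if j = 1 then a else b)
                               else (\<chi> j. if j = 1 then c else d))"

definition opnorm :: "complex^2^2 \<Rightarrow> real" where
  "opnorm A = onorm (\<lambda>x. A *v x)"

fun cocycle_iter :: "real \<Rightarrow> (real \<Rightarrow> complex^2^2) \<Rightarrow> nat \<Rightarrow> real \<Rightarrow> complex^2^2" where
  "cocycle_iter alpha A 0 x = mat 1"
| "cocycle_iter alpha A (Suc n) x = A (x + real n * alpha) ** cocycle_iter alpha A n x"

definition lyap :: "real \<Rightarrow> (real \<Rightarrow> complex^2^2) \<Rightarrow> real" where
  "lyap alpha A = lim (\<lambda>n. (1 / real n) *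
      (LBINT x:{0..1}. ln (opnorm (cocycle_iter alpha A n x))))"

definition jacobi_cocycle ::
  "nat \<Rightarrow> (int \<Rightarrow> complex) \<Rightarrow> int \<Rightarrow> int \<Rightarrow> (int \<Rightarrow> complex) \<Rightarrow> real \<Rightarrow> real \<Rightarrow> real
     \<Rightarrow> real \<Rightarrow> complex^2^2" where
  "jacobi_cocycle M lam N1 N2 mu alpha E eps x =
     mat2 (complex_of_real E - trig_v M lam (Complex x eps))
          (- trig_ct N1 N2 mu (Complex x eps - complex_of_real alpha))
          (trig_c N1 N2 mu (Complex x eps)) 0"

definition Ic :: "int \<Rightarrow> int \<Rightarrow> (int \<Rightarrow> complex) \<Rightarrow> real" where
  "Ic N1 N2 mu = (LBINT x:{0..1}. ln (cmod (trig_c N1 N2 mu (complex_of_real x))))"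

end

theory Submission
  imports Defs
    "HOL-Complex_Analysis.Cauchy_Integral_Formula"
    "HOL-Computational_Algebra.Fundamental_Theorem_Algebra"
    "HOL-Real_Asymp.Real_Asymp"
begin

text \<open>Put \<open>u = exp (i pi (x + i eps))\<close>. After multiplication by \<open>u ^ (N2 - N1)\<close> and conjugation by
  \<open>diag (u ^ (N1 + N2), 1)\<close>, the cocycle becomes a polynomial matrix in \<open>u\<close>, and because \<open>N2 - N1 > 2 M\<close> its
  value at \<open>u = 0\<close> is antidiagonal; so the normalised two-step cocycle \<open>B\<close> satisfies \<open>B(0) = 1\<close>. It remains to see
  that the products \<open>B(z^(n-1) u) ... B(u)\<close>, \<open>z = exp (2 pi i alpha)\<close>, do not grow exponentially on a small
  disc, for every irrational \<open>alpha\<close>. The coefficient of \<open>u ^ k\<close> in this product is a polynomial of degree at most \<open>k\<close>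
  in \<open>z ^ n\<close>, trivially bounded by \<open>C ^ n\<close>; Lagrange interpolation at the nodes \<open>z ^ 0, ..., z ^ k\<close> turns this into a
  bound independent of \<open>n\<close>. If \<open>alpha\<close> is not exponentially well approximable, the node products decay at most
  exponentially in \<open>k\<close>, and the product is bounded for all \<open>n\<close>. Otherwise the argument applies with \<open>n = q\<close>
  for an exceptionally good denominator \<open>q\<close>, because the interpolating polynomials vanish at \<open>1\<close> and \<open>z ^ q\<close> is close
  to \<open>1\<close>.

  The lower bound, which holds for all \<open>eps\<close>, comes from \<open>norm A\<^sup>2 \<ge> abs (det A)\<close> and Jensen's inequality for
  the polynomial \<open>det A\<close>. Negative \<open>eps\<close> reduce to positive ones by the reflection \<open>x \<mapsto> - x\<close>.\<close>

section \<open>Distances to the nearest integer\<close>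

definition nint_dist :: "real \<Rightarrow> real" where
  "nint_dist x = \<bar>x - of_int (round x)\<bar>"

lemma nint_dist_le: "nint_dist x \<le> \<bar>x - of_int m\<bar>"
  unfolding nint_dist_def by (rule round_diff_minimal)

lemma nint_dist_le_half: "nint_dist x \<le> 1/2"
  unfolding nint_dist_def using of_int_round_abs_le[of x] by linarith

lemma nint_dist_nonneg: "nint_dist x \<ge> 0"
  by (simp add: nint_dist_def)

lemma nint_dist_pos:
  assumes "alpha \<notin> \<rat>" "k \<ge> 1"
  shows "nint_dist (alpha * real k) > 0"
proof (rule ccontr)
  assume "\<not> ?thesis"
  then have "alpha * real k = of_int (round (alpha * real k))"
    using nint_dist_nonneg[of "alpha * real k"] by (simp add: nint_dist_def)
  then have "alpha = of_int (round (alpha * real k)) / of_nat k"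
    using assms(2) by (simp add: field_simps)
  then have "alpha \<in> \<rat>"
    by (metis Rats_divide Rats_of_int Rats_of_nat)
  with assms(1) show False by simp
qed

text \<open>If some \<open>m < q\<close> came closer than \<open>1 / (2 * q)\<close>, the integer
  \<open>p * m - r * q\<close> would have absolute value below 1 and hence vanish. Then the distance
  at \<open>m\<close> would be \<open>m / q\<close> times that at \<open>q\<close>, contradicting
  the record property of \<open>q\<close>.\<close>

lemma record_separation:
  assumes q: "q \<ge> 1"
    and recd: "\<And>i. 1 \<le> i \<Longrightarrow> i < q \<Longrightarrow> nint_dist (alpha * real q) < nint_dist (alpha * real i)"
    and m: "1 \<le> m" "m < q"
  shows "nint_dist (alpha * real m) \<ge> 1 / (2 * real q)"
proof (rule ccontr)
  assume "\<not> ?thesis"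
  then have small: "nint_dist (alpha * real m) < 1 / (2 * real q)" by simp
  define p where "p = round (alpha * real q)"
  define r where "r = round (alpha * real m)"
  define t where "t = alpha * real q - of_int p"
  have t: "\<bar>t\<bar> = nint_dist (alpha * real q)"
    by (simp add: t_def p_def nint_dist_def)
  have tm: "\<bar>t\<bar> < nint_dist (alpha * real m)"
    unfolding t by (rule recd[OF m])
  have r: "\<bar>alpha * real m - of_int r\<bar> < 1 / (2 * real q)"
    using small by (simp add: nint_dist_def r_def)
  have eq: "real q * (alpha * real m - of_int r) = t * real m + (of_int p * real m - of_int r * real q)"
    by (simp add: t_def algebra_simps)
  have "real q * \<bar>alpha * real m - of_int r\<bar> < real q * (1 / (2 * real q))"
    using r q by (intro mult_strict_left_mono) auto
  then have "\<bar>real q * (alpha * real m - of_int r)\<bar> < 1/2"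
    using q by (simp add: abs_mult)
  moreover have "\<bar>t * real m\<bar> \<le> \<bar>t\<bar> * real q"
    using m by (simp add: abs_mult mult_left_mono)
  moreover have "\<bar>t\<bar> * real q \<le> 1/2"
  proof -
    have "\<bar>t\<bar> * real q \<le> 1 / (2 * real q) * real q"
      using tm small by (intro mult_right_mono) auto
    then show ?thesis using q by simp
  qed
  ultimately have "\<bar>of_int p * real m - of_int r * real q\<bar> < 1"
    using eq by linarith
  then have "\<bar>real_of_int (p * int m - r * int q)\<bar> < 1" by simp
  then have "p * int m - r * int q = 0" by linarith
  then have "real_of_int (p * int m - r * int q) = 0" by simp
  then have "real q * (alpha * real m - of_int r) = t * real m"
    using eq by simp
  then have "\<bar>alpha * real m - of_int r\<bar> * real q = \<bar>t\<bar> * real m"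
    by (metis abs_mult abs_of_nat mult.commute)
  also have "\<dots> \<le> \<bar>t\<bar> * real q"
    using m by (simp add: mult_left_mono)
  finally have "\<bar>alpha * real m - of_int r\<bar> \<le> \<bar>t\<bar>"
    using q by simp
  with tm show False by (simp add: nint_dist_def r_def)
qed

section \<open>Products of distances over a block of record length\<close>

lemma power_self_le_fact: "real n ^ n \<le> 3 ^ n * fact n"
proof -
  \<comment> \<open>A single term of the exponential series at \<open>n\<close> is at most the whole
    series, and \<open>exp 1 <= 3\<close>.\<close>
  have "(\<Sum>k\<in>{n}. inverse (fact k) * real n ^ k) \<le> (\<Sum>k. inverse (fact k) * real n ^ k)"
    by (rule sum_le_suminf[OF summable_exp]) auto
  also have "\<dots> = exp (real n)"
    by (simp add: exp_def field_simps)
  also have "\<dots> = exp 1 ^ n"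
    by (simp add: exp_of_nat_mult[symmetric])
  also have "\<dots> \<le> 3 ^ n"
    by (intro power_mono exp_le) auto
  finally show ?thesis by (simp add: field_simps)
qed

text \<open>In cells of length \<open>1 / (2 * q)\<close> the separation leaves at most one value
  each, so the product is at least that of the left endpoints, with \<open>th\<close> in place of
  the endpoint 0. The result \<open>th * q! / (2 * q) ^ q\<close> is estimated by
  \<open>q ^ q <= 3 ^ q * q!\<close>.\<close>

lemma packing_prod:
  fixes f :: "nat \<Rightarrow> real"
  assumes q: "q \<ge> 1" and fin: "finite S" and th: "0 < th" "th \<le> 1"
    and f: "\<And>i. i \<in> S \<Longrightarrow> th \<le> f i \<and> f i \<le> 1/2"
    and sep: "\<And>i j. i \<in> S \<Longrightarrow> j \<in> S \<Longrightarrow> i \<noteq> j \<Longrightarrow> \<bar>f i - f j\<bar> \<ge> 1 / (2 * real q)"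
  shows "(\<Prod>i\<in>S. f i) \<ge> th / 6 ^ q"
proof -
  define g where "g i = nat \<lfloor>2 * real q * f i\<rfloor>" for i
  define h where "h m = (if m = 0 then th else real m / (2 * real q))" for m :: nat
  have g_bounds: "real (g i) \<le> 2 * real q * f i \<and> 2 * real q * f i < real (g i) + 1 \<and> g i \<le> q"
    if "i \<in> S" for i
  proof -
    have "0 \<le> 2 * real q * f i" using f[OF that] th by simp
    moreover have "2 * real q * f i \<le> real q"
      using f[OF that] q mult_left_mono[of "f i" "1/2" "2 * real q"] by simp
    ultimately show ?thesis unfolding g_def by linarith
  qed
  have inj: "inj_on g S"
  proof (rule inj_onI, rule ccontr)
    fix i j assume ij: "i \<in> S" "j \<in> S" "g i = g j" "i \<noteq> j"
    have "\<bar>2 * real q * f i - 2 * real q * f j\<bar> < 1"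
      using g_bounds[OF ij(1)] g_bounds[OF ij(2)] ij(3) by linarith
    then have "2 * real q * \<bar>f i - f j\<bar> < 1"
      by (metis abs_mult abs_of_nonneg mult_nonneg_nonneg of_nat_0_le_iff right_diff_distrib zero_le_numeral)
    with sep[OF ij(1,2,4)] q show False by (simp add: field_simps)
  qed
  have h_pos: "h m > 0" for m using th q by (simp add: h_def)
  have h_le: "h m \<le> 1" if "m \<le> q" for m using th q that by (simp add: h_def)
  have "h (g i) \<le> f i" if "i \<in> S" for i
    using f[OF that] g_bounds[OF that] q by (auto simp: h_def field_simps)
  then have "(\<Prod>i\<in>S. h (g i)) \<le> (\<Prod>i\<in>S. f i)"
    by (intro prod_mono) (auto intro: less_imp_le h_pos)
  also have "(\<Prod>i\<in>S. h (g i)) = prod h (g ` S)"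
    by (simp add: prod.reindex[OF inj])
  finally have 1: "prod h (g ` S) \<le> (\<Prod>i\<in>S. f i)" .
  have sub: "g ` S \<subseteq> {..q}" using g_bounds by auto
  \<comment> \<open>Every \<open>h m\<close> is at most 1, so adding the factors of the empty cells
    only lowers the product.\<close>
  have "prod h {..q} = prod h ({..q} - g ` S) * prod h (g ` S)"
    by (rule prod.subset_diff[OF sub]) simp
  also have "\<dots> \<le> 1 * prod h (g ` S)"
    by (intro mult_right_mono prod_le_1 prod_nonneg) (auto intro: less_imp_le h_pos h_le)
  finally have 2: "prod h {..q} \<le> prod h (g ` S)" by simp
  have "prod h {..q} = th * (\<Prod>m\<in>{1..q}. real m / (2 * real q))"
  proof -
    have "{..q} = insert 0 {1..q}" by auto
    moreover have "(\<Prod>m\<in>{1..q}. h m) = (\<Prod>m\<in>{1..q}. real m / (2 * real q))"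
      by (rule prod.cong) (auto simp: h_def)
    ultimately show ?thesis by (simp add: h_def)
  qed
  also have "(\<Prod>m\<in>{1..q}. real m / (2 * real q)) = fact q / (2 * real q) ^ q"
    by (simp add: prod_dividef fact_prod)
  also have "th * (fact q / (2 * real q) ^ q) \<ge> th * (1 / 6 ^ q)"
  proof -
    have "(2 * real q) ^ q \<le> 6 ^ q * fact q"
    proof -
      have "(2 * real q) ^ q \<le> 2 ^ q * (3 ^ q * fact q)"
        unfolding power_mult_distrib by (intro mult_left_mono power_self_le_fact) auto
      also have "\<dots> = 6 ^ q * fact q"
        by (simp add: mult.assoc[symmetric] flip: power_mult_distrib)
      finally show ?thesis .
    qed
    then show ?thesis using th q by (intro mult_left_mono) (simp_all add: field_simps)
  qed
  finally show ?thesis using 1 2 by simp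
qed

text \<open>Two signed residues \<open>x i\<close>, \<open>x j\<close> of the block are separated
  because the index gap is below \<open>q\<close>. Absolute values could bring residues of opposite
  sign together, so the two signs are packed separately; this is the source of the square.\<close>

lemma block_prod:
  assumes q: "q \<ge> 1"
    and recd: "\<And>i. 1 \<le> i \<Longrightarrow> i < q \<Longrightarrow> nint_dist (alpha * real q) < nint_dist (alpha * real i)"
    and S: "S \<subseteq> {a..<a + q}" and th: "0 < th" "th \<le> 1"
    and ge: "\<And>i. i \<in> S \<Longrightarrow> th \<le> nint_dist (alpha * real i)"
  shows "(\<Prod>i\<in>S. nint_dist (alpha * real i)) \<ge> (th / 6 ^ q)\<^sup>2"
proof -
  define x where "x i = alpha * real i - of_int (round (alpha * real i))" for i :: nat
  have nd: "nint_dist (alpha * real i) = \<bar>x i\<bar>" for i by (simp add: x_def nint_dist_def)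
  have fin: "finite S" using S finite_subset by blast
  have sep': "\<bar>x i - x j\<bar> \<ge> 1 / (2 * real q)" if "i \<in> S" "j \<in> S" "j < i" for i j
  proof -
    have "i < a + q" "a \<le> j" using S that by auto
    then have "1 / (2 * real q) \<le> nint_dist (alpha * real (i - j))"
      using that by (intro record_separation[OF q recd]) auto
    also have "\<dots> \<le> \<bar>alpha * real (i - j) - of_int (round (alpha * real i) - round (alpha * real j))\<bar>"
      by (rule nint_dist_le)
    also have "\<dots> = \<bar>x i - x j\<bar>"
      using that by (simp add: x_def of_nat_diff algebra_simps)
    finally show ?thesis .
  qed
  have sep: "\<bar>x i - x j\<bar> \<ge> 1 / (2 * real q)" if "i \<in> S" "j \<in> S" "i \<noteq> j" for i j
    using sep'[of i j] sep'[of j i] that by (cases i j rule: linorder_cases) (auto simp: abs_minus_commute)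
  have xh: "\<bar>x i\<bar> \<le> 1/2" for i using nint_dist_le_half[of "alpha * real i"] nd by simp
  have P: "(\<Prod>i\<in>{i\<in>S. x i \<ge> 0}. \<bar>x i\<bar>) \<ge> th / 6 ^ q"
  proof (rule packing_prod[OF q _ th])
    fix i assume "i \<in> {i\<in>S. x i \<ge> 0}"
    then show "th \<le> \<bar>x i\<bar> \<and> \<bar>x i\<bar> \<le> 1/2" using ge[of i] xh[of i] by (simp add: nd)
  next
    fix i j assume "i \<in> {i\<in>S. x i \<ge> 0}" "j \<in> {i\<in>S. x i \<ge> 0}" "i \<noteq> j"
    then show "\<bar>\<bar>x i\<bar> - \<bar>x j\<bar>\<bar> \<ge> 1 / (2 * real q)" using sep[of i j] by simp
  qed (use fin in auto)
  have N: "(\<Prod>i\<in>{i\<in>S. \<not> x i \<ge> 0}. \<bar>x i\<bar>) \<ge> th / 6 ^ q"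
  proof (rule packing_prod[OF q _ th])
    fix i assume "i \<in> {i\<in>S. \<not> x i \<ge> 0}"
    then show "th \<le> \<bar>x i\<bar> \<and> \<bar>x i\<bar> \<le> 1/2" using ge[of i] xh[of i] by (simp add: nd)
  next
    fix i j assume "i \<in> {i\<in>S. \<not> x i \<ge> 0}" "j \<in> {i\<in>S. \<not> x i \<ge> 0}" "i \<noteq> j"
    then show "\<bar>\<bar>x i\<bar> - \<bar>x j\<bar>\<bar> \<ge> 1 / (2 * real q)"
      using sep[of i j] by (simp add: abs_minus_commute)
  qed (use fin in auto)
  have "(\<Prod>i\<in>S. \<bar>x i\<bar>) = (\<Prod>i\<in>{i\<in>S. x i \<ge> 0} \<union> {i\<in>S. \<not> x i \<ge> 0}. \<bar>x i\<bar>)"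
    by (rule prod.cong) auto
  also have "\<dots> = (\<Prod>i\<in>{i\<in>S. x i \<ge> 0}. \<bar>x i\<bar>) * (\<Prod>i\<in>{i\<in>S. \<not> x i \<ge> 0}. \<bar>x i\<bar>)"
    by (rule prod.union_disjoint) (use fin in auto)
  also have "\<dots> \<ge> (th / 6 ^ q) * (th / 6 ^ q)"
    by (intro mult_mono P N) (use th in \<open>auto intro: prod_nonneg\<close>)
  finally show ?thesis by (simp add: nd power2_eq_square)
qed

section \<open>Badly and exponentially well approximable rotation numbers\<close>

lemma first_argmin:
  fixes f :: "nat \<Rightarrow> real"
  assumes "k \<ge> 1"
  obtains q where "1 \<le> q" "q \<le> k" "\<And>i. 1 \<le> i \<Longrightarrow> i < q \<Longrightarrow> f q < f i"
    "\<And>i. 1 \<le> i \<Longrightarrow> i \<le> k \<Longrightarrow> f q \<le> f i"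
proof -
  define P where "P q \<longleftrightarrow> 1 \<le> q \<and> q \<le> k \<and> (\<forall>i. 1 \<le> i \<and> i \<le> k \<longrightarrow> f q \<le> f i)" for q
  have "\<exists>q\<in>{1..k}. \<forall>i\<in>{1..k}. f q \<le> f i"
    using arg_min_if_finite[of "{1..k}" f] assms
    by (intro bexI[of _ "arg_min_on f {1..k}"]) (auto simp: not_less)
  then have ex: "\<exists>q. P q" by (auto simp: P_def)
  \<comment> \<open>The least minimiser is strictly better than every earlier index, hence a record
    as well as a minimum over the whole range.\<close>
  define q where "q = (LEAST q. P q)"
  have Pq: "P q" unfolding q_def using ex by (rule LeastI_ex)
  have "f q < f i" if "1 \<le> i" "i < q" for i
  proof (rule ccontr)
    assume "\<not> ?thesis"
    then have "P i" using Pq that by (auto simp: P_def intro: order_trans)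
    then show False using that not_less_Least[of i P] by (simp add: q_def)
  qed
  with Pq show ?thesis by (intro that[of q]) (auto simp: P_def)
qed

text \<open>For the best index \<open>q\<close> up to \<open>k\<close>, all distances in the range
  are at least \<open>1 / D ^ q\<close>. A block of length \<open>q\<close> costs a factor
  \<open>W\<close>, exponential in \<open>q\<close>, but only about \<open>k / q\<close> blocks
  occur, so the total loss is exponential in \<open>k\<close>.\<close>

lemma diophantine_prod:
  assumes D: "D \<ge> 1" and dioph: "\<And>k. k \<ge> 1 \<Longrightarrow> nint_dist (alpha * real k) \<ge> 1 / D ^ k"
  shows "(\<Prod>i\<in>{1..k}. nint_dist (alpha * real i)) \<ge> 1 / ((6 * D) ^ 4) ^ k"
proof (cases "k = 0")
  case False
  then have "k \<ge> 1" by simp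
  then obtain q where q: "1 \<le> q" "q \<le> k"
    and recd: "\<And>i. 1 \<le> i \<Longrightarrow> i < q \<Longrightarrow> nint_dist (alpha * real q) < nint_dist (alpha * real i)"
    and min: "\<And>i. 1 \<le> i \<Longrightarrow> i \<le> k \<Longrightarrow> nint_dist (alpha * real q) \<le> nint_dist (alpha * real i)"
    using first_argmin[of k "\<lambda>i. nint_dist (alpha * real i)"] by blast
  define th where "th = 1 / D ^ q"
  have th: "0 < th" "th \<le> 1" using D by (simp_all add: th_def)
  have th_le: "th \<le> nint_dist (alpha * real i)" if "1 \<le> i" "i \<le> k" for i
    using dioph[OF q(1)] min[OF that] by (simp add: th_def)
  define W where "W = (th / 6 ^ q)\<^sup>2"
  have W: "W = 1 / ((6 * D) ^ 2) ^ q"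
  proof -
    have "W = 1 / ((6 * D) ^ q) ^ 2"
      by (simp add: W_def th_def power_mult_distrib power_divide mult.commute)
    then show ?thesis by (metis power_mult mult.commute)
  qed
  have W0: "W > 0" "W \<le> 1"
  proof -
    have "6 * D \<ge> 1" using D by simp
    then have "((6 * D) ^ 2) ^ q \<ge> 1" by (intro one_le_power)
    then show "W > 0" "W \<le> 1" unfolding W by (auto simp: divide_simps)
  qed
  \<comment> \<open>The extra 1 in the exponent pays for a last, incomplete block.\<close>
  have blocks: "(\<Prod>i\<in>{a..<a + l}. nint_dist (alpha * real i)) \<ge> W ^ (l div q + 1)"
    if "1 \<le> a" "a + l \<le> k + 1" for a l
    using that
  proof (induction l arbitrary: a rule: less_induct)
    case (less l)
    show ?case
    proof (cases "l < q")
      case True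
      have "W \<le> (\<Prod>i\<in>{a..<a + l}. nint_dist (alpha * real i))"
        unfolding W_def using less.prems True
        by (intro block_prod[OF q(1) recd, of _ a] th) (auto intro!: th_le)
      then show ?thesis using True by simp
    next
      case False
      have "(\<Prod>i\<in>{a..<a + l}. nint_dist (alpha * real i))
          = (\<Prod>i\<in>{a..<a + q}. nint_dist (alpha * real i)) * (\<Prod>i\<in>{a + q..<a + q + (l - q)}. nint_dist (alpha * real i))"
        using False by (subst prod.atLeastLessThan_concat) auto
      also have "\<dots> \<ge> W * W ^ ((l - q) div q + 1)"
      proof (rule mult_mono)
        show "W \<le> (\<Prod>i\<in>{a..<a + q}. nint_dist (alpha * real i))"
          unfolding W_def using less.prems False
          by (intro block_prod[OF q(1) recd, of _ a] th) (auto intro!: th_le)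
        show "W ^ ((l - q) div q + 1) \<le> (\<Prod>i\<in>{a + q..<a + q + (l - q)}. nint_dist (alpha * real i))"
          using less.prems False q by (intro less.IH) auto
      qed (use W0 in \<open>auto intro: prod_nonneg nint_dist_nonneg\<close>)
      also have "W * W ^ ((l - q) div q + 1) = W ^ (l div q + 1)"
        using False q by (simp add: le_div_geq)
      finally show ?thesis .
    qed
  qed
  have "1 / ((6 * D) ^ 4) ^ k = 1 / ((6 * D) ^ 2) ^ (2 * k)"
  proof -
    have "4 * k = 2 * (2 * k)" by simp
    then have "((6 * D) ^ 4) ^ k = ((6 * D) ^ 2) ^ (2 * k)" by (metis power_mult)
    then show ?thesis by (rule arg_cong)
  qed
  also have "\<dots> \<le> 1 / ((6 * D) ^ 2) ^ (q * (k div q + 1))"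
  proof (rule divide_left_mono)
    \<comment> \<open>The blocks cover at most \<open>k + q <= 2 * k\<close> indices; this doubling
      turns the exponent 2 in \<open>W\<close> into 4.\<close>
    have "q * (k div q + 1) \<le> 2 * k"
      using q times_div_less_eq_dividend[of q k] unfolding distrib_left by linarith
    then show "((6 * D) ^ 2) ^ (q * (k div q + 1)) \<le> ((6 * D) ^ 2) ^ (2 * k)"
      using D by (intro power_increasing one_le_power) auto
  qed (use D in auto)
  also have "\<dots> = W ^ (k div q + 1)"
    unfolding W power_mult by (simp only: power_one_over)
  also have "\<dots> \<le> (\<Prod>i\<in>{1..<1 + k}. nint_dist (alpha * real i))"
    by (rule blocks) auto
  also have "{1..<1 + k} = {1..k}" by auto
  finally show ?thesis .
qed auto

text \<open>An exceptional index \<open>k\<close> is replaced by the first minimiser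
  \<open>q <= k\<close>. Its distance is no larger, and \<open>1 / D' ^ k <= 1 / D' ^ q\<close>
  keeps it exponentially small in terms of \<open>q\<close>.\<close>

lemma liouville_record:
  assumes irr: "alpha \<notin> \<rat>"
    and liou: "\<And>D. D \<ge> 1 \<Longrightarrow> \<exists>k\<ge>1. nint_dist (alpha * real k) < 1 / D ^ k"
    and D: "D \<ge> 1"
  obtains q where "q > n0" "q \<ge> 1" "nint_dist (alpha * real q) < 1 / D ^ q"
    "\<And>i. 1 \<le> i \<Longrightarrow> i < q \<Longrightarrow> nint_dist (alpha * real q) < nint_dist (alpha * real i)"
proof -
  \<comment> \<open>\<open>Suc n0\<close> keeps the set nonempty. Because
    \<open>1 / D' <= d\<close>, the distance at \<open>q\<close> will fall below all distances up to
    \<open>Suc n0\<close>, which forces \<open>q > n0\<close>.\<close>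
  define d where "d = Min ((\<lambda>i. nint_dist (alpha * real i)) ` {1..Suc n0})"
  have d: "d > 0" unfolding d_def using nint_dist_pos[OF irr] by (subst Min_gr_iff) auto
  define D' where "D' = max D (1 / d)"
  have D': "D' \<ge> 1" "D' \<ge> D" "D' \<ge> 1 / d" using D by (auto simp: D'_def)
  obtain k where k: "k \<ge> 1" "nint_dist (alpha * real k) < 1 / D' ^ k"
    using liou[OF D'(1)] by blast
  obtain q where q: "1 \<le> q" "q \<le> k"
    and recd: "\<And>i. 1 \<le> i \<Longrightarrow> i < q \<Longrightarrow> nint_dist (alpha * real q) < nint_dist (alpha * real i)"
    and min: "\<And>i. 1 \<le> i \<Longrightarrow> i \<le> k \<Longrightarrow> nint_dist (alpha * real q) \<le> nint_dist (alpha * real i)"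
    using first_argmin[of k "\<lambda>i. nint_dist (alpha * real i)"] k by blast
  have "nint_dist (alpha * real q) < 1 / D' ^ k"
    using min[of k] k by linarith
  also have "\<dots> \<le> 1 / D' ^ q"
    using D' q by (intro divide_left_mono power_increasing) auto
  finally have lt: "nint_dist (alpha * real q) < 1 / D' ^ q" .
  also have "1 / D' ^ q \<le> 1 / D ^ q"
    using D' D by (intro divide_left_mono power_mono) auto
  finally have ltD: "nint_dist (alpha * real q) < 1 / D ^ q" .
  have "1 / D' ^ q \<le> 1 / D' ^ 1"
    using D' q by (intro divide_left_mono power_increasing) auto
  also have "\<dots> \<le> d" using D' d by (simp add: field_simps)
  finally have "nint_dist (alpha * real q) < d" using lt by linarith
  then have "q > n0"
    unfolding d_def using q by (subst (asm) Min_gr_iff) (auto simp: not_less)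
  then show ?thesis using q recd ltD by (intro that) auto
qed

section \<open>Interpolation at powers of a point on the unit circle\<close>

text \<open>The chord has length \<open>2 * \<bar>sin (pi * y)\<bar>\<close> for the signed residue
  \<open>y\<close>. The constants are not sharp; only their independence of \<open>alpha\<close> and
  \<open>i\<close> matters.\<close>

lemma norm_1_minus_cis:
  shows norm_1_minus_cis_ge: "cmod (1 - cis (2 * pi * alpha) ^ i) \<ge> nint_dist (alpha * real i)"
    and norm_1_minus_cis_le: "cmod (1 - cis (2 * pi * alpha) ^ i) \<le> 7 * nint_dist (alpha * real i)"
proof -
  define y where "y = alpha * real i - of_int (round (alpha * real i))"
  have "cis (2 * pi * alpha) ^ i = cis (2 * pi * (alpha * real i))"
    by (simp add: Complex.DeMoivre mult_ac)
  also have "\<dots> = cis (2 * pi * y) * cis (2 * pi * of_int (round (alpha * real i)))"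
    by (simp add: y_def cis_mult algebra_simps)
  also have "\<dots> = cis (2 * pi * y)" by simp
  finally have "cmod (1 - cis (2 * pi * alpha) ^ i) = cmod (exp (\<i> * of_real (2 * pi * y)) - 1)"
    by (simp add: cis_conv_exp norm_minus_commute)
  also have "\<dots> = 2 * \<bar>sin (pi * y)\<bar>"
    by (subst dist_exp_i_1) (simp add: mult.assoc)
  also have "\<bar>sin (pi * y)\<bar> = \<bar>sin (pi * \<bar>y\<bar>)\<bar>"
    by (cases "y \<ge> 0") auto
  finally have eq: "cmod (1 - cis (2 * pi * alpha) ^ i) = 2 * \<bar>sin (pi * \<bar>y\<bar>)\<bar>" .
  have nd: "nint_dist (alpha * real i) = \<bar>y\<bar>" by (simp add: nint_dist_def y_def)
  have y: "\<bar>y\<bar> \<le> 1/2" using nint_dist_le_half[of "alpha * real i"] nd by simp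
  \<comment> \<open>Up to 1/6 the mean value theorem applies with a cosine of at least 1/2; beyond,
    the sine is at least 1/2 by monotonicity.\<close>
  have "\<bar>y\<bar> \<le> 2 * sin (pi * \<bar>y\<bar>)"
  proof (cases "\<bar>y\<bar> \<le> 1/6")
    case True
    show ?thesis
    proof (cases "y = 0")
      case False
      have "\<exists>z>0. z < pi * \<bar>y\<bar> \<and> sin (pi * \<bar>y\<bar>) - sin 0 = (pi * \<bar>y\<bar> - 0) * cos z"
        using False by (intro MVT2) (auto intro!: derivative_eq_intros)
      then obtain z where z: "0 < z" "z < pi * \<bar>y\<bar>" "sin (pi * \<bar>y\<bar>) = pi * \<bar>y\<bar> * cos z" by auto
      have "pi * \<bar>y\<bar> \<le> pi / 3" using True by simp
      then have "cos (pi / 3) \<le> cos z"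
        using z(1,2) by (intro cos_monotone_0_pi_le) linarith+
      then have c: "1/2 \<le> cos z" by (simp add: cos_60)
      have "1 * \<bar>y\<bar> \<le> pi * \<bar>y\<bar>" using pi_ge_two by (intro mult_right_mono) auto
      also have "\<dots> \<le> pi * \<bar>y\<bar> * (2 * cos z)" using c mult_left_mono[of 1 "2 * cos z" "pi * \<bar>y\<bar>"] by simp
      finally show ?thesis using z by simp
    qed simp
  next
    case False
    have "sin (pi / 6) \<le> sin (pi * \<bar>y\<bar>)"
      using False y by (intro sin_monotone_2pi_le) auto
    then show ?thesis using y by (simp add: sin_30)
  qed
  then show "cmod (1 - cis (2 * pi * alpha) ^ i) \<ge> nint_dist (alpha * real i)"
    unfolding eq nd by linarith
  have "\<bar>sin (pi * \<bar>y\<bar>)\<bar> \<le> pi * \<bar>y\<bar>"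
    using abs_sin_x_le_abs_x[of "pi * \<bar>y\<bar>"] by (simp add: abs_mult)
  also have "\<dots> \<le> 7/2 * \<bar>y\<bar>" using pi_less_4 pi_approx by (intro mult_right_mono) auto
  finally show "cmod (1 - cis (2 * pi * alpha) ^ i) \<le> 7 * nint_dist (alpha * real i)"
    unfolding eq nd by simp
qed

lemma lagrange_interpolation:
  fixes p :: "'a::field poly"
  assumes fin: "finite I" and inj: "inj_on x I" and deg: "degree p < card I"
  shows "poly p t = (\<Sum>n\<in>I. poly p (x n) * (\<Prod>m\<in>I - {n}. (t - x m) / (x n - x m)))"
proof -
  define q where "q = (\<Sum>n\<in>I. smult (poly p (x n)) (\<Prod>m\<in>I - {n}. smult (1 / (x n - x m)) [:- x m, 1:]))"
  have q: "poly q t = (\<Sum>n\<in>I. poly p (x n) * (\<Prod>m\<in>I - {n}. (t - x m) / (x n - x m)))" for t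
    by (simp add: q_def poly_sum poly_prod diff_divide_distrib)
  have "degree q \<le> card I - 1"
    unfolding q_def
  proof (rule degree_sum_le)
    fix n assume n: "n \<in> I"
    have "degree (\<Prod>m\<in>I - {n}. smult (1 / (x n - x m)) [:- x m, 1:])
        \<le> (\<Sum>m\<in>I - {n}. degree (smult (1 / (x n - x m)) [:- x m, 1:]))"
      using degree_prod_sum_le[of "I - {n}" "\<lambda>m. smult (1 / (x n - x m)) [:- x m, 1:]"] fin
      by (simp add: o_def)
    also have "\<dots> \<le> (\<Sum>m\<in>I - {n}. 1)"
      by (intro sum_mono) (auto intro: order_trans[OF degree_smult_le])
    also have "\<dots> = card I - 1" using fin n by simp
    finally show "degree (smult (poly p (x n)) (\<Prod>m\<in>I - {n}. smult (1 / (x n - x m)) [:- x m, 1:])) \<le> card I - 1"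
      using degree_smult_le order_trans by blast
  qed (use fin in auto)
  moreover have "poly p s = poly q s" if s: "s \<in> x ` I" for s
  proof -
    obtain j where j: "j \<in> I" "s = x j" using s by auto
    have "(\<Prod>m\<in>I - {n}. (x j - x m) / (x n - x m)) = (if n = j then 1 else 0)" if n: "n \<in> I" for n
    proof (cases "n = j")
      case True
      moreover have "x j \<noteq> x m" if "m \<in> I - {j}" for m
        using inj_onD[OF inj, of j m] j that by auto
      ultimately show ?thesis by (auto intro!: prod.neutral)
    next
      case False
      then show ?thesis using fin j by (auto intro!: bexI[of _ j])
    qed
    then have "poly q s = (\<Sum>n\<in>I. if n = j then poly p (x j) else 0)"
      unfolding q j(2) by (intro sum.cong) auto
    then show ?thesis using j fin by simp
  qed
  ultimately have "p = q"
    using deg by (intro poly_eqI_degree[of "x ` I"]) (auto simp: card_image[OF inj])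
  then have "poly p t = poly q t" by (rule arg_cong)
  then show ?thesis using q by (rule trans)
qed

text \<open>Up to a unimodular factor, the difference of two nodes depends only on the index gap.
  The Lagrange denominators thus reduce to the products over initial segments estimated
  before.\<close>

lemma node_prod:
  assumes "n \<le> k" "cmod z = 1"
  shows "(\<Prod>m\<in>{..k} - {n}. cmod (z ^ n - z ^ m))
    = (\<Prod>i\<in>{1..n}. cmod (1 - z ^ i)) * (\<Prod>i\<in>{1..k - n}. cmod (1 - z ^ i))"
proof -
  have split: "{..k} - {n} = {..<n} \<union> {n<..k}" using assms(1) by auto
  have "(\<Prod>m\<in>{..k} - {n}. cmod (z ^ n - z ^ m))
    = (\<Prod>m\<in>{..<n}. cmod (z ^ n - z ^ m)) * (\<Prod>m\<in>{n<..k}. cmod (z ^ n - z ^ m))"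
    unfolding split by (rule prod.union_disjoint) auto
  also have "(\<Prod>m\<in>{..<n}. cmod (z ^ n - z ^ m)) = (\<Prod>i\<in>{1..n}. cmod (1 - z ^ i))"
  proof (rule prod.reindex_bij_witness[of _ "\<lambda>i. n - i" "\<lambda>m. n - m"])
    fix m assume "m \<in> {..<n}"
    then have "z ^ n = z ^ m * z ^ (n - m)" by (simp flip: power_add)
    then have "z ^ n - z ^ m = - (z ^ m * (1 - z ^ (n - m)))"
      by (simp only: right_diff_distrib) simp
    then show "cmod (1 - z ^ (n - m)) = cmod (z ^ n - z ^ m)"
      by (simp add: norm_mult norm_power assms(2))
  qed auto
  also have "(\<Prod>m\<in>{n<..k}. cmod (z ^ n - z ^ m)) = (\<Prod>i\<in>{1..k - n}. cmod (1 - z ^ i))"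
  proof (rule prod.reindex_bij_witness[of _ "\<lambda>i. n + i" "\<lambda>m. m - n"])
    fix m assume "m \<in> {n<..k}"
    then have "z ^ m = z ^ n * z ^ (m - n)" by (simp flip: power_add)
    then have "z ^ n - z ^ m = z ^ n * (1 - z ^ (m - n))"
      by (simp only: right_diff_distrib) simp
    then show "cmod (1 - z ^ (m - n)) = cmod (z ^ n - z ^ m)"
      by (simp add: norm_mult norm_power assms(2))
  qed auto
  finally show ?thesis .
qed

text \<open>Each Lagrange denominator splits into two node products, and each of the at most
  \<open>k\<close> numerator factors is at most 2 on the unit circle. If \<open>p\<close> vanishes
  at \<open>1 = z ^ 0\<close>, the summand of that node drops out and every other numerator contains
  the factor \<open>t - 1\<close>.\<close>

lemma interpolation_bound:
  fixes p :: "complex poly"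
  assumes deg: "degree p \<le> k" and z: "cmod z = 1" and t: "cmod t = 1"
    and V: "V > 0" and nodes: "\<And>n. n \<le> k \<Longrightarrow> (\<Prod>i\<in>{1..n}. cmod (1 - z ^ i)) \<ge> V"
    and M: "\<And>n. n \<le> k \<Longrightarrow> cmod (poly p (z ^ n)) \<le> M"
  shows "cmod (poly p t) \<le> real (k + 1) * (M * (2 ^ k / V\<^sup>2))"
    and "k \<ge> 1 \<Longrightarrow> poly p 1 = 0 \<Longrightarrow>
      cmod (poly p t) \<le> real (k + 1) * (M * (2 ^ k / V\<^sup>2)) * cmod (t - 1)"
proof -
  have M0: "M \<ge> 0" using M[of 0] norm_ge_zero order_trans by blast
  have den: "(\<Prod>m\<in>{..k} - {n}. cmod (z ^ n - z ^ m)) \<ge> V\<^sup>2" if "n \<le> k" for n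
    unfolding node_prod[OF that z] power2_eq_square
    using V that by (intro mult_mono nodes) (auto intro: prod_nonneg)
  \<comment> \<open>Coinciding nodes would make a node product zero, against
    \<open>den\<close>.\<close>
  have inj: "inj_on (\<lambda>n. z ^ n) {..k}"
  proof (rule inj_onI, rule ccontr)
    fix n m assume nm: "n \<in> {..k}" "m \<in> {..k}" "z ^ n = z ^ m" "n \<noteq> m"
    then have "(\<Prod>m\<in>{..k} - {n}. cmod (z ^ n - z ^ m)) = 0"
      by (intro prod_zero bexI[of _ m]) auto
    then show False using den[of n] nm(1) V by (simp only: atMost_iff) (simp add: not_le[symmetric])
  qed
  have L: "poly p t = (\<Sum>n\<in>{..k}. poly p (z ^ n) * (\<Prod>m\<in>{..k} - {n}. (t - z ^ m) / (z ^ n - z ^ m)))"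
    using deg by (intro lagrange_interpolation inj) auto
  have two: "cmod (t - z ^ m) \<le> 2" for m
    using norm_triangle_ineq4[of t "z ^ m"] by (simp add: t z norm_power)
  have num: "(\<Prod>m\<in>S. cmod (t - z ^ m)) \<le> 2 ^ k" if "finite S" "card S \<le> k" for S
  proof -
    have "(\<Prod>m\<in>S. cmod (t - z ^ m)) \<le> (\<Prod>m\<in>S. 2)"
      by (intro prod_mono) (auto simp: two)
    also have "\<dots> \<le> 2 ^ k" using that by (auto intro: power_increasing)
    finally show ?thesis .
  qed
  have summand: "cmod (poly p (z ^ n) * (\<Prod>m\<in>{..k} - {n}. (t - z ^ m) / (z ^ n - z ^ m))) \<le> M * (N / V\<^sup>2)"
    if n: "n \<le> k" and N: "(\<Prod>m\<in>{..k} - {n}. cmod (t - z ^ m)) \<le> N" for n N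
  proof -
    have "cmod (\<Prod>m\<in>{..k} - {n}. (t - z ^ m) / (z ^ n - z ^ m))
       = (\<Prod>m\<in>{..k} - {n}. cmod (t - z ^ m)) / (\<Prod>m\<in>{..k} - {n}. cmod (z ^ n - z ^ m))"
      by (simp add: norm_divide prod_dividef flip: prod_norm)
    also have "\<dots> \<le> N / V\<^sup>2"
    proof (rule frac_le[OF _ N _ den[OF n]])
      show "0 \<le> N" by (rule order_trans[OF prod_nonneg N]) simp
    qed (use V in simp)
    finally show ?thesis unfolding norm_mult using M[OF n] M0 by (intro mult_mono) auto
  qed
  have "cmod (poly p t) \<le> (\<Sum>n\<in>{..k}. M * (2 ^ k / V\<^sup>2))"
    unfolding L by (intro sum_norm_le summand num) (auto simp: card_Diff_singleton_if)
  then show "cmod (poly p t) \<le> real (k + 1) * (M * (2 ^ k / V\<^sup>2))" by (simp add: add.commute)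
  assume k: "k \<ge> 1" and p1: "poly p 1 = 0"
  have "cmod (poly p (z ^ n) * (\<Prod>m\<in>{..k} - {n}. (t - z ^ m) / (z ^ n - z ^ m)))
      \<le> M * ((2 ^ k * cmod (t - 1)) / V\<^sup>2)" if n: "n \<le> k" for n
  proof (cases "n = 0")
    case True
    then show ?thesis using p1 M0 by simp
  next
    case False
    have "(\<Prod>m\<in>{..k} - {n}. cmod (t - z ^ m)) = cmod (t - z ^ 0) * (\<Prod>m\<in>{..k} - {n} - {0}. cmod (t - z ^ m))"
      using False by (intro prod.remove) auto
    also have "\<dots> \<le> cmod (t - z ^ 0) * 2 ^ k"
    proof (intro mult_left_mono num)
      have "card ({..k} - {n} - {0}) \<le> card ({..k} - {n})" by (intro card_mono) auto
      then show "card ({..k} - {n} - {0}) \<le> k" using n by simp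
    qed auto
    finally show ?thesis by (intro summand n) (simp add: mult.commute)
  qed
  then have "cmod (poly p t) \<le> (\<Sum>n\<in>{..k}. M * ((2 ^ k * cmod (t - 1)) / V\<^sup>2))"
    unfolding L by (intro sum_norm_le) auto
  then show "cmod (poly p t) \<le> real (k + 1) * (M * (2 ^ k / V\<^sup>2)) * cmod (t - 1)"
    by (simp add: add.commute)
qed

section \<open>Products of near-identity polynomial matrices along a rotation\<close>

text \<open>The entries of \<open>B(z ^ (n - 1) * u) ... B(u)\<close> as polynomials in
  \<open>u\<close>; composition with \<open>[:0, z ^ n:]\<close> substitutes
  \<open>z ^ n * u\<close>.\<close>

fun orbit_poly :: "complex \<Rightarrow> ('n::finite \<Rightarrow> 'n \<Rightarrow> complex poly) \<Rightarrow> nat \<Rightarrow> 'n \<Rightarrow> 'n \<Rightarrow> complex poly" where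
  "orbit_poly z B 0 i j = (if i = j then 1 else 0)"
| "orbit_poly z B (Suc n) i j = (\<Sum>l\<in>UNIV. pcompose (B i l) [:0, z ^ n:] * orbit_poly z B n l j)"

lemma coeff_orbit_poly_Suc:
  "coeff (orbit_poly z B (Suc n) i j) k =
    (\<Sum>l\<in>UNIV. \<Sum>s\<le>k. (z ^ n) ^ s * coeff (B i l) s * coeff (orbit_poly z B n l j) (k - s))"
  by (simp add: coeff_sum coeff_mult coeff_pcompose_linear)

text \<open>The rotation only inserts unimodular factors, so each new matrix multiplies the bound by
  at most the sum of the moduli of all coefficients of \<open>B\<close>. Hence \<open>C\<close> is
  uniform in \<open>z\<close> and in the order \<open>k\<close>.\<close>

lemma orbit_poly_coeff_bound:
  fixes B :: "'n::finite \<Rightarrow> 'n \<Rightarrow> complex poly"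
  obtains C where "C \<ge> 1"
    "\<And>z n k i j. cmod z = 1 \<Longrightarrow> cmod (coeff (orbit_poly z B n i j) k) \<le> C ^ n"
proof -
  define C where "C = 1 + (\<Sum>i\<in>UNIV. \<Sum>l\<in>UNIV. \<Sum>s\<le>degree (B i l). cmod (coeff (B i l) s))"
  have C: "C \<ge> 1" unfolding C_def by (simp add: sum_nonneg)
  have le: "(\<Sum>s\<le>k. cmod (coeff (B i l) s)) \<le> (\<Sum>s\<le>degree (B i l). cmod (coeff (B i l) s))" for i l k
  proof -
    have "(\<Sum>s\<le>k. cmod (coeff (B i l) s)) = (\<Sum>s\<in>{..k} \<inter> {..degree (B i l)}. cmod (coeff (B i l) s))"
      by (rule sum.mono_neutral_right) (auto intro: le_degree)
    also have "\<dots> \<le> (\<Sum>s\<le>degree (B i l). cmod (coeff (B i l) s))"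
      by (rule sum_mono2) auto
    finally show ?thesis .
  qed
  have row: "(\<Sum>l\<in>UNIV. \<Sum>s\<le>k. cmod (coeff (B i l) s)) \<le> C" for i k
  proof -
    have "(\<Sum>l\<in>UNIV. \<Sum>s\<le>k. cmod (coeff (B i l) s)) \<le> (\<Sum>l\<in>UNIV. \<Sum>s\<le>degree (B i l). cmod (coeff (B i l) s))"
      by (intro sum_mono le)
    also have "\<dots> \<le> (\<Sum>i\<in>UNIV. \<Sum>l\<in>UNIV. \<Sum>s\<le>degree (B i l). cmod (coeff (B i l) s))"
      by (rule member_le_sum) (auto intro!: sum_nonneg)
    finally show ?thesis by (simp add: C_def)
  qed
  have "cmod (coeff (orbit_poly z B n i j) k) \<le> C ^ n" if z: "cmod z = 1" for z n k i j
  proof (induction n arbitrary: i k)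
    case 0
    show ?case by (simp add: coeff_1)
  next
    case (Suc n)
    have "cmod (coeff (orbit_poly z B (Suc n) i j) k)
      \<le> (\<Sum>l\<in>UNIV. \<Sum>s\<le>k. cmod (coeff (B i l) s) * C ^ n)"
      unfolding coeff_orbit_poly_Suc
      by (intro sum_norm_le) (auto simp: norm_mult norm_power z intro!: mult_left_mono Suc.IH)
    also have "\<dots> = (\<Sum>l\<in>UNIV. \<Sum>s\<le>k. cmod (coeff (B i l) s)) * C ^ n"
      by (simp add: sum_distrib_right)
    also have "\<dots> \<le> C * C ^ n"
      using C by (intro mult_right_mono row) auto
    finally show ?case by simp
  qed
  with C show ?thesis by (rule that)
qed

text \<open>The equation is diagonal on monomials: coefficient \<open>i\<close> is divided by
  \<open>z ^ i - 1\<close>. Order 0, where the divisor vanishes, is excluded by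
  \<open>coeff Q 0 = 0\<close>. Small divisors do no harm, as only the degree of \<open>P\<close> is
  recorded.\<close>

lemma poly_cohomological:
  fixes Q :: "complex poly"
  assumes z: "\<And>m. m \<ge> 1 \<Longrightarrow> z ^ m \<noteq> 1" and Q: "degree Q \<le> k" "coeff Q 0 = 0"
  obtains P where "degree P \<le> k" "\<And>n. poly P (z ^ Suc n) - poly P (z ^ n) = poly Q (z ^ n)"
proof -
  define P where "P = (\<Sum>i\<in>{1..k}. monom (coeff Q i / (z ^ i - 1)) i)"
  have "degree P \<le> k"
    unfolding P_def by (rule degree_sum_le) (auto intro: order_trans[OF degree_monom_le])
  moreover have "poly P (z ^ Suc n) - poly P (z ^ n) = poly Q (z ^ n)" for n
  proof -
    have "poly P (z ^ Suc n) - poly P (z ^ n)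
      = (\<Sum>i\<in>{1..k}. coeff Q i / (z ^ i - 1) * (z ^ Suc n) ^ i - coeff Q i / (z ^ i - 1) * (z ^ n) ^ i)"
      by (simp add: P_def poly_sum poly_monom sum_subtractf)
    also have "\<dots> = (\<Sum>i\<in>{1..k}. coeff Q i * (z ^ n) ^ i)"
    proof (rule sum.cong)
      fix i assume "i \<in> {1..k}"
      then have "z ^ i - 1 \<noteq> 0" using z by auto
      moreover have "coeff Q i / (z ^ i - 1) * (z ^ Suc n) ^ i - coeff Q i / (z ^ i - 1) * (z ^ n) ^ i
        = coeff Q i / (z ^ i - 1) * (z ^ i - 1) * (z ^ n) ^ i"
        unfolding power_Suc power_mult_distrib by (simp only: right_diff_distrib left_diff_distrib mult_ac mult_1_right mult_1_left)
      ultimately show "coeff Q i / (z ^ i - 1) * (z ^ Suc n) ^ i - coeff Q i / (z ^ i - 1) * (z ^ n) ^ i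
        = coeff Q i * (z ^ n) ^ i" by simp
    qed simp
    also have "\<dots> = (\<Sum>i\<le>k. coeff Q i * (z ^ n) ^ i)"
    proof (rule sum.mono_neutral_left)
      show "\<forall>i\<in>{..k} - {1..k}. coeff Q i * (z ^ n) ^ i = 0"
      proof
        fix i assume "i \<in> {..k} - {1..k}"
        then have "i = 0" by auto
        then show "coeff Q i * (z ^ n) ^ i = 0" using Q(2) by simp
      qed
    qed auto
    also have "\<dots> = poly Q (z ^ n)"
      unfolding poly_altdef by (rule sum.mono_neutral_right) (use Q in \<open>auto intro: le_degree\<close>)
    finally show ?thesis .
  qed
  ultimately show ?thesis by (rule that)
qed

text \<open>The recursion for the coefficients only involves the trigonometric sums of the powers
  \<open>z ^ (n * s)\<close> with \<open>s \<ge> 1\<close>, all of which can be summed exactly because \<open>z\<close> is not a root of unity.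
  So, although \<open>n\<close> is unbounded, the coefficient of order \<open>k\<close> depends on \<open>n\<close> through a polynomial of degree
  at most \<open>k\<close> in \<open>z ^ n\<close>.\<close>

lemma orbit_poly_coeff_eq_poly:
  fixes B :: "'n::finite \<Rightarrow> 'n \<Rightarrow> complex poly"
  assumes z: "\<And>m. m \<ge> 1 \<Longrightarrow> z ^ m \<noteq> 1" and B0: "\<And>i l. coeff (B i l) 0 = (if i = l then 1 else 0)"
  shows "\<exists>p. degree p \<le> k \<and> (\<forall>n. coeff (orbit_poly z B n i j) k = poly p (z ^ n))"
proof (induction k arbitrary: i rule: less_induct)
  case (less k)
  have "\<forall>k' l. \<exists>p. k' < k \<longrightarrow> degree p \<le> k' \<and> (\<forall>n. coeff (orbit_poly z B n l j) k' = poly p (z ^ n))"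
    using less.IH by blast
  then obtain p where p: "\<And>k' l. k' < k \<Longrightarrow> degree (p k' l) \<le> k'"
    "\<And>k' l n. k' < k \<Longrightarrow> coeff (orbit_poly z B n l j) k' = poly (p k' l) (z ^ n)"
    by metis
  \<comment> \<open>\<open>Q\<close> collects the orders \<open>s >= 1\<close> of the new factor,
    which meet coefficients of lower order. Order 0 reproduces the coefficient of order
    \<open>k\<close>, since \<open>B\<close> is the identity at 0.\<close>
  define Q where "Q = (\<Sum>l\<in>UNIV. \<Sum>s\<in>{1..k}. monom (coeff (B i l) s) s * p (k - s) l)"
  have degQ: "degree Q \<le> k"
    unfolding Q_def
  proof (intro degree_sum_le)
    fix l s assume s: "s \<in> {1..k}"
    have "degree (monom (coeff (B i l) s) s * p (k - s) l) \<le> degree (monom (coeff (B i l) s) s) + degree (p (k - s) l)"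
      by (rule degree_mult_le)
    also have "\<dots> \<le> s + (k - s)" using s by (intro add_mono degree_monom_le p) auto
    finally show "degree (monom (coeff (B i l) s) s * p (k - s) l) \<le> k" using s by simp
  qed auto
  have Q0: "coeff Q 0 = 0"
    unfolding Q_def coeff_sum by (intro sum.neutral ballI) (auto simp: coeff_mult)
  have step: "coeff (orbit_poly z B (Suc n) i j) k = coeff (orbit_poly z B n i j) k + poly Q (z ^ n)" for n
  proof -
    have "(\<Sum>s\<le>k. (z ^ n) ^ s * coeff (B i l) s * coeff (orbit_poly z B n l j) (k - s))
      = (if i = l then coeff (orbit_poly z B n i j) k else 0)
        + (\<Sum>s\<in>{1..k}. poly (monom (coeff (B i l) s) s * p (k - s) l) (z ^ n))" for l
    proof -
      have "{..k} = insert 0 {1..k}" by auto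
      then have "(\<Sum>s\<le>k. (z ^ n) ^ s * coeff (B i l) s * coeff (orbit_poly z B n l j) (k - s))
        = coeff (B i l) 0 * coeff (orbit_poly z B n l j) k
          + (\<Sum>s\<in>{1..k}. (z ^ n) ^ s * coeff (B i l) s * coeff (orbit_poly z B n l j) (k - s))"
        by simp
      moreover have "(\<Sum>s\<in>{1..k}. (z ^ n) ^ s * coeff (B i l) s * coeff (orbit_poly z B n l j) (k - s))
        = (\<Sum>s\<in>{1..k}. poly (monom (coeff (B i l) s) s * p (k - s) l) (z ^ n))"
        by (intro sum.cong) (auto simp: poly_monom p(2))
      ultimately show ?thesis by (simp add: B0)
    qed
    then show ?thesis
      unfolding coeff_orbit_poly_Suc by (simp add: sum.distrib Q_def poly_sum)
  qed
  obtain P where P: "degree P \<le> k" "\<And>n. poly P (z ^ Suc n) - poly P (z ^ n) = poly Q (z ^ n)"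
    using poly_cohomological[OF z degQ Q0] by blast
  \<comment> \<open>The constant adjusts the value at \<open>n = 0\<close>, where
    \<open>z ^ 0 = 1\<close>.\<close>
  define c where "c = coeff (orbit_poly z B 0 i j) k - poly P 1"
  have "coeff (orbit_poly z B n i j) k = poly (P + [:c:]) (z ^ n)" for n
  proof (induction n)
    case 0
    show ?case by (simp add: c_def)
  next
    case (Suc n)
    then show ?case using P(2)[of n] by (simp only: step) (simp add: algebra_simps)
  qed
  moreover have "degree (P + [:c:]) \<le> k" using P(1) by (intro degree_add_le) auto
  ultimately show ?case by blast
qed

text \<open>Arbitrarily large \<open>n\<close> suffice, because the exponent is an infimum over
  \<open>n\<close>. The weights \<open>(1/2) ^ k\<close> make the polynomials bounded on the disc of
  radius \<open>rho\<close>.\<close>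

lemma orbit_poly_subexponential:
  fixes B :: "'n::finite \<Rightarrow> 'n \<Rightarrow> complex poly"
  assumes irr: "alpha \<notin> \<rat>" and B0: "\<And>i l. coeff (B i l) 0 = (if i = l then 1 else 0)"
  obtains rho where "rho > 0"
    "\<And>n0. \<exists>n>n0. \<forall>i j k. cmod (coeff (orbit_poly (cis (2 * pi * alpha)) B n i j) k) * rho ^ k \<le> (1/2) ^ k"
proof -
  define z where "z = cis (2 * pi * alpha)"
  have z1: "cmod z = 1" by (simp add: z_def)
  note d_ge = norm_1_minus_cis_ge[of alpha, folded z_def]
  note d_le = norm_1_minus_cis_le[of alpha, folded z_def]
  have nz: "z ^ m \<noteq> 1" if "m \<ge> 1" for m
    using d_ge[of m] nint_dist_pos[OF irr that] by auto
  obtain C where C: "C \<ge> 1" "\<And>n k i j. cmod (coeff (orbit_poly z B n i j) k) \<le> C ^ n"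
    using orbit_poly_coeff_bound[of B] z1 by metis
  have "\<exists>p. \<forall>k i j. degree (p k i j) \<le> k \<and> (\<forall>n. coeff (orbit_poly z B n i j) k = poly (p k i j) (z ^ n))"
    using orbit_poly_coeff_eq_poly[OF nz B0] by metis
  then obtain p where p: "\<And>k i j. degree (p k i j) \<le> k"
    "\<And>k i j n. coeff (orbit_poly z B n i j) k = poly (p k i j) (z ^ n)" by metis
  have p_node: "cmod (poly (p k i j) (z ^ n)) \<le> C ^ n" for k i j n
    using C(2) p(2) by metis
  have p_node': "cmod (poly (p k i j) (z ^ n)) \<le> C ^ k" if "n \<le> k" for k i j n
    using p_node[of k i j n] power_increasing[OF that C(1)] by linarith
  have zn: "cmod (z ^ n) = 1" for n by (simp add: norm_power z1)
  have prod_d: "(\<Prod>i\<in>S. nint_dist (alpha * real i)) \<le> (\<Prod>i\<in>S. cmod (1 - z ^ i))" for S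
    by (intro prod_mono) (auto simp: nint_dist_nonneg d_ge)
  show ?thesis
  proof (cases "\<exists>D\<ge>1. \<forall>k\<ge>1. nint_dist (alpha * real k) \<ge> 1 / D ^ k")
    case True
    then obtain D where D: "D \<ge> 1" "\<And>k. k \<ge> 1 \<Longrightarrow> nint_dist (alpha * real k) \<ge> 1 / D ^ k"
      by blast
    define F where "F = (6 * D) ^ 4"
    have F: "F \<ge> 1" unfolding F_def using D by (intro one_le_power) auto
    have nodes: "(\<Prod>i\<in>{1..n}. cmod (1 - z ^ i)) \<ge> 1 / F ^ k" if "n \<le> k" for n k
    proof -
      have "1 / F ^ k \<le> 1 / F ^ n"
        using F that by (intro divide_left_mono power_increasing) auto
      also have "\<dots> \<le> (\<Prod>i\<in>{1..n}. nint_dist (alpha * real i))"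
        unfolding F_def by (rule diophantine_prod[OF D])
      finally show ?thesis using prod_d order_trans by blast
    qed
    \<comment> \<open>Interpolation yields \<open>(4 * C * F ^ 2) ^ k\<close>: a 2 for
      \<open>k + 1 <= 2 ^ k\<close>, a 2 for the numerators, \<open>F ^ 2\<close> for the two node
      products. A further 2 produces \<open>(1/2) ^ k\<close>.\<close>
    define rho where "rho = 1 / (8 * C * F\<^sup>2)"
    have rho: "rho > 0" using C F by (simp add: rho_def)
    have "cmod (coeff (orbit_poly z B n i j) k) * rho ^ k \<le> (1/2) ^ k" for n i j k
    proof -
      have "cmod (poly (p k i j) (z ^ n)) \<le> real (k + 1) * (C ^ k * (2 ^ k / (1 / F ^ k)\<^sup>2))"
        using F by (intro interpolation_bound(1)[OF p(1) z1 zn] nodes p_node') auto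
      also have "\<dots> \<le> 2 ^ k * (C ^ k * (2 ^ k / (1 / F ^ k)\<^sup>2))"
      proof (rule mult_right_mono)
        have "k + 1 \<le> 2 ^ k" by (induction k) auto
        then show "real (k + 1) \<le> 2 ^ k" using of_nat_mono[of "k + 1" "2 ^ k", where 'a = real] by simp
      qed (use C F in auto)
      also have "\<dots> = (4 * C * F\<^sup>2) ^ k"
      proof -
        have "(1 / F ^ k)\<^sup>2 = 1 / (F\<^sup>2) ^ k"
          by (simp add: power_divide mult.commute flip: power_mult)
        moreover have "(2::real) ^ k * 2 ^ k = 4 ^ k" by (simp flip: power_mult_distrib)
        ultimately show ?thesis by (simp add: power_mult_distrib)
      qed
      finally have "cmod (coeff (orbit_poly z B n i j) k) * rho ^ k \<le> (4 * C * F\<^sup>2) ^ k * rho ^ k"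
        using rho by (intro mult_right_mono) (auto simp: p(2))
      also have "\<dots> = (1/2) ^ k"
      proof -
        have "4 * C * F\<^sup>2 * rho = 1/2" using C F by (simp add: rho_def field_simps)
        then show ?thesis by (simp only: power_mult_distrib[symmetric])
      qed
      finally show ?thesis .
    qed
    then show ?thesis using rho unfolding z_def by (intro that[of rho]) blast+
  next
    case False
    then have liou: "\<exists>k\<ge>1. nint_dist (alpha * real k) < 1 / D ^ k" if "D \<ge> 1" for D
      using that False by (meson not_le)
    \<comment> \<open>This is \<open>24 ^ 4\<close>: the inverse square of \<open>V\<close> below is
      \<open>(2 * q * 6 ^ q) ^ 4\<close>, and \<open>2 * q <= 4 ^ q\<close>.\<close>
    define G :: real where "G = (16 * 36) ^ 2"
    define rho where "rho = 1 / (4 * C)"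
    have rho: "rho > 0" "rho \<le> 1" using C by (auto simp: rho_def)
    have "\<exists>n>n0. \<forall>i j k. cmod (coeff (orbit_poly z B n i j) k) * rho ^ k \<le> (1/2) ^ k" for n0
    proof -
      \<comment> \<open>In \<open>14 * G\<close> a factor 2 cancels \<open>k + 1 <= 2 ^ q\<close>,
        \<open>G\<close> cancels the small node products, and the remaining \<open>7 ^ q\<close>
        beats the constant 7 of the chord bound.\<close>
      obtain q where q: "q > n0" "q \<ge> 1" and close: "nint_dist (alpha * real q) < 1 / (14 * G) ^ q"
        and recd: "\<And>i. 1 \<le> i \<Longrightarrow> i < q \<Longrightarrow> nint_dist (alpha * real q) < nint_dist (alpha * real i)"
        using liouville_record[OF irr liou, of "14 * G" n0] by (auto simp: G_def)
      define th where "th = 1 / (2 * real q)"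
      have th: "0 < th" "th \<le> 1" using q by (auto simp: th_def)
      define V where "V = (th / 6 ^ q)\<^sup>2"
      have V: "V > 0" using th by (simp add: V_def)
      have nodes: "(\<Prod>i\<in>{1..n}. cmod (1 - z ^ i)) \<ge> V" if "n < q" for n
      proof -
        have "V \<le> (\<Prod>i\<in>{1..n}. nint_dist (alpha * real i))"
          unfolding V_def using that
          by (intro block_prod[OF q(2) recd, of _ 1] th) (auto simp: th_def intro!: record_separation recd)
        then show ?thesis using prod_d order_trans by blast
      qed
      have V_le: "1 / V\<^sup>2 \<le> G ^ q"
      proof -
        have "2 * m \<le> 4 ^ m" for m :: nat
        proof (induction m)
          case (Suc m)
          moreover have "(1::nat) \<le> 4 ^ m" by simp
          ultimately show ?case unfolding power_Suc mult_Suc_right by linarith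
        qed simp
        then have "real (2 * q) \<le> real (4 ^ q)" by (intro of_nat_mono)
        then have "2 * real q \<le> 4 ^ q" by simp
        then have "2 * real q * 6 ^ q \<le> 4 ^ q * 6 ^ q" by (intro mult_right_mono) auto
        also have "\<dots> = 24 ^ q" by (simp flip: power_mult_distrib)
        finally have "(2 * real q * 6 ^ q) ^ 4 \<le> (24 ^ q) ^ 4" by (intro power_mono) auto
        also have "\<dots> = (24 ^ 4) ^ q" by (metis power_mult mult.commute)
        also have "(24 ^ 4 :: real) = G" by (simp add: G_def)
        finally show ?thesis by (simp add: V_def th_def power_divide flip: power_mult)
      qed
      have "cmod (coeff (orbit_poly z B q i j) k) * rho ^ k \<le> (1/2) ^ k" for i j k
      proof -
        \<comment> \<open>Order 0 does not depend on \<open>n\<close>. For \<open>1 <= k < q\<close>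
          the coefficient vanishes at \<open>n = 0\<close>, so the interpolating polynomial has the
          zero 1, and the closeness of \<open>z ^ q\<close> to 1 compensates for the node products.
          From \<open>k = q\<close> on, the trivial bound \<open>C ^ q <= C ^ k\<close> is
          enough.\<close>
        consider "k = 0" | "1 \<le> k" "k < q" | "q \<le> k" by linarith
        then show ?thesis
        proof cases
          case 1
          obtain a where a: "p 0 i j = [:a:]" using p(1)[of 0 i j] degree_eq_zeroE by auto
          have "coeff (orbit_poly z B n i j) 0 = a" for n by (simp only: p(2) a) simp
          then have "coeff (orbit_poly z B q i j) 0 = coeff (orbit_poly z B 0 i j) 0" by metis
          then show ?thesis using 1 by simp
        next
          case 2
          have "poly (p k i j) (z ^ 0) = 0"
            unfolding p(2)[symmetric] using 2 by simp
          then have p1: "poly (p k i j) 1 = 0" by simp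
          have "cmod (poly (p k i j) (z ^ q)) \<le> real (k + 1) * (C ^ k * (2 ^ k / V\<^sup>2)) * cmod (z ^ q - 1)"
            using 2 V by (intro interpolation_bound(2)[OF p(1) z1 zn] nodes p_node' p1) auto
          also have "\<dots> \<le> 2 ^ q * (C ^ k * (2 ^ k * G ^ q)) * (7 * (1 / (14 * G) ^ q))"
          proof (intro mult_mono)
            have "q < 2 ^ q" by (rule less_exp)
            then have "k + 1 \<le> 2 ^ q" using 2 by linarith
            then show "real (k + 1) \<le> 2 ^ q" using of_nat_mono[of "k + 1" "2 ^ q", where 'a = real] by simp
            show "2 ^ k / V\<^sup>2 \<le> 2 ^ k * G ^ q"
              using mult_left_mono[OF V_le, of "2 ^ k"] by simp
            show "cmod (z ^ q - 1) \<le> 7 * (1 / (14 * G) ^ q)"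
              using d_le[of q] close by (simp add: norm_minus_commute)
          qed (use C in \<open>auto simp: G_def\<close>)
          also have "\<dots> = (2 * C) ^ k * (7 * (1/7) ^ q)"
            by (simp add: power_mult_distrib power_divide G_def divide_simps) (simp flip: power_mult_distrib)
          also have "\<dots> \<le> (2 * C) ^ k * 1"
          proof (rule mult_left_mono)
            have "(1/7 :: real) ^ q \<le> (1/7) ^ 1" using q by (intro power_decreasing) auto
            then show "7 * (1/7 :: real) ^ q \<le> 1" by simp
          qed (use C in auto)
          finally have "cmod (coeff (orbit_poly z B q i j) k) * rho ^ k \<le> (2 * C) ^ k * rho ^ k"
            using rho by (intro mult_right_mono) (auto simp: p(2))
          also have "\<dots> = (1/2) ^ k"
          proof -
            have "2 * C * rho = 1/2" using C by (simp add: rho_def field_simps)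
            then show ?thesis by (simp only: power_mult_distrib[symmetric])
          qed
          finally show ?thesis .
        next
          case 3
          have "cmod (coeff (orbit_poly z B q i j) k) \<le> C ^ q" by (rule C(2))
          also have "\<dots> \<le> C ^ k" using 3 C by (intro power_increasing)
          finally have "cmod (coeff (orbit_poly z B q i j) k) * rho ^ k \<le> C ^ k * rho ^ k"
            using rho by (intro mult_right_mono) auto
          also have "\<dots> = (1/4) ^ k"
          proof -
            have "C * rho = 1/4" using C by (simp add: rho_def field_simps)
            then show ?thesis by (simp only: power_mult_distrib[symmetric])
          qed
          also have "\<dots> \<le> (1/2) ^ k" by (intro power_mono) auto
          finally show ?thesis .
        qed
      qed
      then show ?thesis using q by blast
    qed
    then show ?thesis using rho unfolding z_def by (intro that[of rho]) blast+
  qed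
qed

lemma poly_bound_of_coeff_bound:
  fixes p :: "complex poly"
  assumes "\<And>k. cmod (coeff p k) * rho ^ k \<le> (1/2) ^ k" and "cmod u \<le> rho"
  shows "cmod (poly p u) \<le> 2"
proof -
  have "cmod (poly p u) \<le> (\<Sum>k\<le>degree p. (1/2) ^ k)"
    unfolding poly_altdef
  proof (intro sum_norm_le)
    fix k
    have "cmod (coeff p k * u ^ k) \<le> cmod (coeff p k) * rho ^ k"
      using assms(2) by (auto simp: norm_mult norm_power intro!: mult_left_mono power_mono)
    then show "cmod (coeff p k * u ^ k) \<le> (1/2) ^ k" using assms(1)[of k] by linarith
  qed
  also have "\<dots> \<le> (\<Sum>k. (1/2) ^ k)"
    by (rule sum_le_suminf[OF summable_geometric]) auto
  also have "\<dots> = 2" by (simp add: suminf_geometric)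
  finally show ?thesis .
qed

section \<open>Jensen's inequality\<close>

lemma AE_cis_neq: "AE x in lborel. cis (2 * pi * x) \<noteq> c"
proof -
  have "countable {x. cis (2 * pi * x) = c}"
  proof (cases "\<exists>x0. cis (2 * pi * x0) = c")
    case True
    then obtain x0 where x0: "cis (2 * pi * x0) = c" by blast
    have "{x. cis (2 * pi * x) = c} \<subseteq> range (\<lambda>n::int. x0 + of_int n)"
    proof
      fix x assume "x \<in> {x. cis (2 * pi * x) = c}"
      then have "cis (2 * pi * x) = cis (2 * pi * x0)" using x0 by simp
      then have "cis (2 * pi * x) / cis (2 * pi * x0) = 1" by simp
      then have "cis (2 * pi * x - 2 * pi * x0) = 1" by (simp add: cis_divide)
      then have "exp (\<i> * of_real (2 * pi * x - 2 * pi * x0)) = 1" by (simp add: cis_conv_exp)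
      then obtain n :: int where "2 * pi * x - 2 * pi * x0 = of_int (2 * n) * pi"
        by (auto simp: exp_eq_1)
      then have "2 * pi * x = 2 * pi * (x0 + of_int n)" by (simp add: algebra_simps)
      then have "x = x0 + of_int n" by simp
      then show "x \<in> range (\<lambda>n::int. x0 + of_int n)" by blast
    qed
    then show ?thesis by (rule countable_subset) simp
  qed simp
  then have "{x. cis (2 * pi * x) = c} \<in> null_sets lborel"
    by (rule countable_imp_null_set_lborel)
  from AE_not_in[OF this] show ?thesis by simp
qed

lemma measurable_ln_cmod_cis:
  assumes "continuous_on UNIV f"
  shows "(\<lambda>x. ln (cmod (f (c * cis (2 * pi * x))))) \<in> borel_measurable borel"
proof -
  have "continuous_on UNIV (\<lambda>x. c * cis (2 * pi * x))" by (intro continuous_intros)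
  then have "continuous_on UNIV (\<lambda>x. f (c * cis (2 * pi * x)))"
    by (rule continuous_on_compose2[OF assms]) simp
  then have "(\<lambda>x. cmod (f (c * cis (2 * pi * x)))) \<in> borel_measurable borel"
    by (intro borel_measurable_continuous_onI continuous_intros)
  then show ?thesis by (rule borel_measurable_ln)
qed

text \<open>On the closed unit disc \<open>1 - a * w\<close> stays in the right half-plane, so its
  principal logarithm is holomorphic there. Cauchy's formula at the centre gives the mean
  \<open>Ln 1 = 0\<close>, and the real part is taken.\<close>

lemma jensen_inside:
  assumes "cmod a < 1"
  shows "set_integrable lborel {0..1} (\<lambda>x. ln (cmod (1 - a * cis (2 * pi * x))))"
    and "(LBINT x:{0..1}. ln (cmod (1 - a * cis (2 * pi * x)))) = 0"
proof -
  have pos: "Re (1 - a * w) > 0" if "cmod w \<le> 1" for w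
  proof -
    have "cmod (a * w) \<le> cmod a * 1" unfolding norm_mult using that by (intro mult_left_mono) auto
    then have "\<bar>Re (a * w)\<bar> < 1" using assms abs_Re_le_cmod[of "a * w"] by linarith
    then show ?thesis by simp
  qed
  have nz: "1 - a * w \<noteq> 0" if "cmod w \<le> 1" for w
    using pos[OF that] by (metis less_irrefl zero_complex.sel(1))
  define f where "f w = Ln (1 - a * w)" for w
  have "f holomorphic_on cball 0 1"
    unfolding f_def
  proof (intro holomorphic_intros)
    fix w assume "w \<in> cball (0::complex) 1"
    then show "1 - a * w \<notin> \<real>\<^sub>\<le>\<^sub>0" using pos[of w] by (auto simp: complex_nonpos_Reals_iff)
  qed
  then have "((\<lambda>u. f u / (u - 0)) has_contour_integral (2 * of_real pi * \<i> * f 0)) (circlepath 0 1)"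
    by (rule Cauchy_integral_circlepath_simple) simp
  then have "((\<lambda>x. f (exp (2 * of_real pi * \<i> * of_real x)) * (2 * of_real pi * \<i>))
      has_integral 2 * of_real pi * \<i> * f 0) {0..1}"
    unfolding has_contour_integral_def
    by (rule has_integral_eq[rotated]) (simp add: vector_derivative_circlepath01, simp add: circlepath)
  then have "((\<lambda>x. f (exp (2 * of_real pi * \<i> * of_real x)) * (2 * of_real pi * \<i>) * (1 / (2 * of_real pi * \<i>))) has_integral 2 * of_real pi * \<i> * f 0 * (1 / (2 * of_real pi * \<i>))) {0..1}"
    by (rule has_integral_mult_left)
  then have "((\<lambda>x. f (cis (2 * pi * x))) has_integral 0) {0..1}"
    by (simp add: cis_conv_exp mult_ac f_def)
  then have "((\<lambda>x. Re (f (cis (2 * pi * x)))) has_integral Re 0) {0..1}"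
    by (rule has_integral_Re)
  then have int: "((\<lambda>x. ln (cmod (1 - a * cis (2 * pi * x)))) has_integral 0) {0..1}"
    unfolding zero_complex.sel
  proof (rule has_integral_eq[rotated])
    fix x :: real
    have "1 - a * cis (2 * pi * x) \<noteq> 0" by (rule nz) simp
    then show "Re (f (cis (2 * pi * x))) = ln (cmod (1 - a * cis (2 * pi * x)))"
      by (simp add: f_def)
  qed
  show *: "set_integrable lborel {0..1} (\<lambda>x. ln (cmod (1 - a * cis (2 * pi * x))))"
    using nz[of "cis (2 * pi * x)" for x] by (intro borel_integrable_atLeastAtMost' continuous_intros) auto
  show "(LBINT x:{0..1}. ln (cmod (1 - a * cis (2 * pi * x)))) = 0"
    using set_borel_integral_eq_integral(2)[OF *] integral_unique[OF int] by simp
qed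

text \<open>The integrand has a logarithmic singularity, so \<open>a\<close> is approached radially
  by \<open>s n * a\<close>, where the previous case applies. Monotone convergence gives
  integrability and value at once, as the approximating integrals are, up to sign,
  \<open>ln (s n)\<close>, which tends to 0.\<close>

lemma jensen_boundary:
  assumes a: "cmod a = 1"
  shows "set_integrable lborel {0..1} (\<lambda>x. ln (cmod (1 - a * cis (2 * pi * x))))"
    and "(LBINT x:{0..1}. ln (cmod (1 - a * cis (2 * pi * x)))) = 0"
proof -
  define s where "s n = 1 - 1 / real (n + 2)" for n :: nat
  define e where "e x = a * cis (2 * pi * x)" for x
  have e1: "cmod (e x) = 1" for x by (simp add: e_def norm_mult a)
  have s: "0 < s n" "s n < 1" for n by (auto simp: s_def)
  have s_mono: "s m \<le> s n" if "m \<le> n" for m n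
    using that by (auto simp: s_def intro!: divide_left_mono)
  have s_lim: "s \<longlonglongrightarrow> 1" unfolding s_def by real_asymp
  have dist2: "(cmod (1 - of_real r * e x))\<^sup>2 = 1 + r\<^sup>2 - 2 * r * Re (e x)" for r x
  proof -
    have "(Re (e x))\<^sup>2 + (Im (e x))\<^sup>2 = 1" using e1[of x] by (simp add: cmod_power2[symmetric])
    moreover have "(cmod (1 - of_real r * e x))\<^sup>2 = 1 - 2 * r * Re (e x) + r\<^sup>2 * ((Re (e x))\<^sup>2 + (Im (e x))\<^sup>2)"
      unfolding cmod_power2 by (simp add: power2_eq_square algebra_simps)
    ultimately show ?thesis by simp
  qed
  have Re_le: "Re (e x) \<le> 1" for x using complex_Re_le_cmod[of "e x"] e1[of x] by simp
  \<comment> \<open>Dividing the squared distance by \<open>s\<close> makes the approximation monotone in \<open>s\<close>.\<close>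
  define g where "g n x = s n + 1 / s n - 2 * Re (e x)" for n x
  have g_eq: "ln (g n x) = 2 * ln (cmod (1 - of_real (s n) * e x)) - ln (s n)" for n x
  proof -
    have "cmod (of_real (s n) * e x) < 1" using s[of n] by (simp add: norm_mult e1)
    then have nz: "1 - of_real (s n) * e x \<noteq> 0" by auto
    have "g n x = (cmod (1 - of_real (s n) * e x))\<^sup>2 / s n"
      unfolding dist2 g_def using s[of n] by (simp add: field_simps power2_eq_square)
    then show ?thesis using nz s[of n] by (simp add: ln_div ln_realpow)
  qed
  have s_anti: "s n + 1 / s n \<le> s m + 1 / s m" if "m \<le> n" for m n
  proof -
    \<comment> \<open>This product is \<open>s m * s n\<close> times the right side minus the left
      side.\<close>
    have "(s n - s m) * (1 - s m * s n) \<ge> 0"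
      using s_mono[OF that] s[of n] s[of m] mult_le_one[of "s m" "s n"] by (intro mult_nonneg_nonneg) auto
    then show ?thesis using s[of n] s[of m] by (simp add: field_simps)
  qed
  have s2: "s n + 1 / s n > 2" for n
  proof -
    have "(1 - s n)\<^sup>2 > 0" using s[of n] by simp
    then show ?thesis using s[of n] by (simp add: field_simps power2_eq_square)
  qed
  have g_pos: "g n x > 0" for n x using s2[of n] Re_le[of x] by (simp add: g_def)
  have int: "set_integrable lborel {0..1} (\<lambda>x. ln (g n x))" "(LBINT x:{0..1}. ln (g n x)) = - ln (s n)" for n
  proof -
    have lt: "cmod (of_real (s n) * a) < 1" using s[of n] by (simp add: norm_mult a)
    have i: "set_integrable lborel {0..1} (\<lambda>x. ln (cmod (1 - of_real (s n) * e x)))"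
      "(LBINT x:{0..1}. ln (cmod (1 - of_real (s n) * e x))) = 0"
      using jensen_inside[OF lt] by (simp_all add: e_def mult.assoc)
    have c: "set_integrable lborel {0..1::real} (\<lambda>x. ln (s n))"
      by (intro borel_integrable_atLeastAtMost' continuous_intros)
    show "set_integrable lborel {0..1} (\<lambda>x. ln (g n x))"
      unfolding g_eq using i c by (intro set_integral_diff set_integrable_mult_right)
    have "(LBINT x:{0..1}. ln (g n x)) = 2 * (LBINT x:{0..1}. ln (cmod (1 - of_real (s n) * e x))) - (LBINT x:{0..1::real}. ln (s n))"
      unfolding g_eq using i c by (subst set_integral_diff) auto
    also have "(LBINT x:{0..1::real}. ln (s n)) = ln (s n)"
      by (simp add: set_lebesgue_integral_def)
    finally show "(LBINT x:{0..1}. ln (g n x)) = - ln (s n)" using i by simp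
  qed
  have e_neq: "AE x in lborel. e x \<noteq> 1"
    using AE_cis_neq[of "1 / a"] 
  proof eventually_elim
    case (elim x)
    have "a \<noteq> 0" using a by auto
    then show ?case using elim by (simp add: e_def eq_divide_eq mult.commute)
  qed
  have meas: "(\<lambda>x. ln (cmod (1 - e x))) \<in> borel_measurable borel"
    unfolding e_def by (intro borel_measurable_ln borel_measurable_continuous_onI continuous_intros)
  define F where "F n x = indicator {0..1} x *\<^sub>R - ln (g n x)" for n and x :: real
  define U where "U x = indicator {0..1} x *\<^sub>R (- 2 * ln (cmod (1 - e x)))" for x :: real
  have F1: "integrable lborel (F n)" for n
    using int(1)[of n] unfolding F_def set_integrable_def by (simp add: minus_mult_right[symmetric])
  have F2: "integral\<^sup>L lborel (F n) = ln (s n)" for n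
    using int(2)[of n] unfolding F_def set_lebesgue_integral_def by simp
  have F3: "AE x in lborel. mono (\<lambda>n. F n x)"
  proof (rule AE_I2, rule monoI)
    fix x :: real and m n :: nat assume mn: "m \<le> n"
    have "g n x \<le> g m x" using s_anti[OF mn] by (simp add: g_def)
    then have "ln (g n x) \<le> ln (g m x)" using g_pos[of n x] g_pos[of m x] by simp
    then show "F m x \<le> F n x" unfolding F_def by (cases "x \<in> {0..1}") auto
  qed
  have F4: "AE x in lborel. (\<lambda>n. F n x) \<longlonglongrightarrow> U x"
    using e_neq
  proof eventually_elim
    fix x assume x: "e x \<noteq> 1"
    have "(\<lambda>n. 2 * ln (cmod (1 - of_real (s n) * e x)) - ln (s n))
        \<longlonglongrightarrow> 2 * ln (cmod (1 - of_real 1 * e x)) - ln 1"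
      using x by (intro tendsto_intros s_lim) auto
    from tendsto_minus[OF this] show "(\<lambda>n. F n x) \<longlonglongrightarrow> U x"
      unfolding F_def U_def g_eq by (intro tendsto_scaleR tendsto_const) simp
  qed
  have F5: "(\<lambda>n. integral\<^sup>L lborel (F n)) \<longlonglongrightarrow> 0"
    unfolding F2 using tendsto_ln[OF s_lim] by simp
  note meas [measurable]
  have U: "U \<in> borel_measurable lborel" unfolding U_def by measurable
  have U1: "integrable lborel U" "integral\<^sup>L lborel U = 0"
    by (rule integrable_monotone_convergence[OF F1 F3 F4 F5 U], rule integral_monotone_convergence[OF F1 F3 F4 F5 U])
  have "(\<lambda>x. indicator {0..1} x *\<^sub>R ln (cmod (1 - e x))) = (\<lambda>x. (- 1/2) * U x)"
    by (auto simp: U_def)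
  moreover have "integrable lborel (\<lambda>x. (- 1/2) * U x)" "integral\<^sup>L lborel (\<lambda>x. (- 1/2) * U x) = 0"
    using U1 by simp_all
  ultimately show "set_integrable lborel {0..1} (\<lambda>x. ln (cmod (1 - a * cis (2 * pi * x))))"
    "(LBINT x:{0..1}. ln (cmod (1 - a * cis (2 * pi * x)))) = 0"
    unfolding set_integrable_def set_lebesgue_integral_def e_def[symmetric] by (simp_all only:)
qed

text \<open>For a coefficient outside the disc, reflection in the unit circle replaces
  \<open>a\<close> by \<open>b = 1 / cnj a\<close> at the cost of the factor \<open>cmod a\<close>;
  the mean is then \<open>ln (cmod a) > 0\<close>.\<close>

lemma jensen_factor:
  shows "set_integrable lborel {0..1} (\<lambda>x. ln (cmod (1 - a * cis (2 * pi * x))))"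
    and "(LBINT x:{0..1}. ln (cmod (1 - a * cis (2 * pi * x)))) \<ge> 0"
proof -
  have "set_integrable lborel {0..1} (\<lambda>x. ln (cmod (1 - a * cis (2 * pi * x))))
    \<and> (LBINT x:{0..1}. ln (cmod (1 - a * cis (2 * pi * x)))) \<ge> 0"
  proof (cases "cmod a" "1::real" rule: linorder_cases)
    case less
    then show ?thesis using jensen_inside by simp
  next
    case equal
    then show ?thesis using jensen_boundary by simp
  next
    case greater
    then have a: "a \<noteq> 0" by auto
    define b where "b = cnj (1 / a)"
    have b: "cmod b < 1" using greater by (simp add: b_def norm_divide divide_simps)
    have "ln (cmod (1 - a * cis t)) = ln (cmod a) + ln (cmod (1 - b * cis t))" for t
    proof -
      have "cnj (1 - b * cis t) = 1 - cnj (cis t) / a" by (simp add: b_def)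
      also have "cnj (cis t) = 1 / cis t" by (simp add: cis_cnj cis_inverse flip: inverse_eq_divide)
      finally have "cnj (1 - b * cis t) * (- a * cis t) = 1 - a * cis t"
        using a by (simp add: field_simps)
      then have "cmod (1 - a * cis t) = cmod (1 - b * cis t) * cmod a"
        by (metis (no_types, lifting) complex_mod_cnj mult.right_neutral norm_cis norm_minus_cancel norm_mult)
      moreover have "1 - b * cis t \<noteq> 0"
        using b norm_mult[of b "cis t"] by auto
      ultimately show ?thesis using a by (simp add: ln_mult)
    qed
    moreover have c: "set_integrable lborel {0..1::real} (\<lambda>x. ln (cmod a))"
      by (intro borel_integrable_atLeastAtMost' continuous_intros)
    moreover have "(LBINT x:{0..1::real}. ln (cmod a)) = ln (cmod a)"
      by (simp add: set_lebesgue_integral_def)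
    ultimately show ?thesis
      using set_integral_add[OF c jensen_inside(1)[OF b]] jensen_inside(2)[OF b] greater by simp
  qed
  then show "set_integrable lborel {0..1} (\<lambda>x. ln (cmod (1 - a * cis (2 * pi * x))))"
    and "(LBINT x:{0..1}. ln (cmod (1 - a * cis (2 * pi * x)))) \<ge> 0" by blast+
qed

text \<open>Roots are split off as \<open>1 - w / z\<close>, which is 1 at the origin, so
  \<open>poly P 0\<close> is unchanged and every factor adds a nonnegative mean. Nonvanishing almost
  everywhere is carried along, since the logarithm of the product is split only where no factor
  vanishes.\<close>

lemma jensen_poly:
  assumes "poly P 0 \<noteq> 0"
  shows "set_integrable lborel {0..1} (\<lambda>x. ln (cmod (poly P (c * cis (2 * pi * x))))) \<and>
    ln (cmod (poly P 0)) \<le> (LBINT x:{0..1}. ln (cmod (poly P (c * cis (2 * pi * x))))) \<and>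
    (AE x in lborel. poly P (c * cis (2 * pi * x)) \<noteq> 0)"
  using assms
proof (induction "degree P" arbitrary: P)
  case 0
  then obtain k where k: "P = [:k:]" using degree_eq_zeroE by metis
  have "set_integrable lborel {0..1::real} (\<lambda>x. ln (cmod k))"
    by (intro borel_integrable_atLeastAtMost' continuous_intros)
  then show ?case using k 0 by (simp add: set_lebesgue_integral_def)
next
  case (Suc d)
  have "\<not> constant (poly P)" using Suc.hyps(2) constant_degree[of P] by simp
  then obtain z where z: "poly P z = 0" using fundamental_theorem_of_algebra by blast
  have z0: "z \<noteq> 0" using z Suc.prems by auto
  obtain Q where Q: "P = [:- z, 1:] * Q" using z by (metis dvdE poly_eq_0_iff_dvd)
  define R where "R = smult (- z) Q"
  have P: "poly P w = (1 - (1 / z) * w) * poly R w" for w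
    using z0 by (simp add: Q R_def field_simps)
  have "P \<noteq> 0" using Suc.prems by auto
  then have "Q \<noteq> 0" using Q by auto
  then have "degree P = 1 + degree Q" unfolding Q by (subst degree_mult_eq) auto
  then have "degree R = d" using Suc.hyps(2) z0 by (simp add: R_def)
  moreover have R0: "poly R 0 = poly P 0" using P[of 0] by simp
  ultimately have IH: "set_integrable lborel {0..1} (\<lambda>x. ln (cmod (poly R (c * cis (2 * pi * x)))))"
    "ln (cmod (poly R 0)) \<le> (LBINT x:{0..1}. ln (cmod (poly R (c * cis (2 * pi * x)))))"
    "AE x in lborel. poly R (c * cis (2 * pi * x)) \<noteq> 0"
    using Suc.hyps(1)[of R] Suc.prems by auto
  have fac: "AE x in lborel. 1 - (1 / z) * (c * cis (2 * pi * x)) \<noteq> 0"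
    \<comment> \<open>For \<open>c = 0\<close> the factor is constantly 1, whatever
      \<open>z / c\<close> means.\<close>
    using AE_cis_neq[of "z / c"] by eventually_elim (use z0 in \<open>cases "c = 0"; auto simp: field_simps\<close>)
  have nz: "AE x in lborel. poly P (c * cis (2 * pi * x)) \<noteq> 0"
    using IH(3) fac by eventually_elim (simp add: P)
  have eq: "AE x in lborel. ln (cmod (poly P (c * cis (2 * pi * x))))
    = ln (cmod (1 - c / z * cis (2 * pi * x))) + ln (cmod (poly R (c * cis (2 * pi * x))))"
    using IH(3) fac by eventually_elim (simp add: P norm_mult ln_mult)
  have sum: "set_integrable lborel {0..1} (\<lambda>x. ln (cmod (1 - c / z * cis (2 * pi * x))) + ln (cmod (poly R (c * cis (2 * pi * x)))))"
    by (intro set_integral_add jensen_factor IH)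
  have meas: "(\<lambda>x. ln (cmod (poly P' (c * cis (2 * pi * x))))) \<in> borel_measurable lborel" for P'
    by (simp, rule measurable_ln_cmod_cis) (intro continuous_intros)
  have meas': "(\<lambda>x. ln (cmod (1 - c / z * cis (2 * pi * x))) + ln (cmod (poly R (c * cis (2 * pi * x))))) \<in> borel_measurable lborel"
    by (intro borel_measurable_add meas) (use measurable_ln_cmod_cis[of "\<lambda>w. 1 - w" "c / z"] in \<open>simp add: continuous_intros\<close>)
  have eq': "AE x\<in>{0..1} in lborel. ln (cmod (poly P (c * cis (2 * pi * x))))
    = ln (cmod (1 - c / z * cis (2 * pi * x))) + ln (cmod (poly R (c * cis (2 * pi * x))))"
    using eq by eventually_elim simp
  have int: "set_integrable lborel {0..1} (\<lambda>x. ln (cmod (poly P (c * cis (2 * pi * x)))))"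
    using sum set_integrable_cong_AE[OF meas meas' eq'] by (simp only: sets_lborel) simp
  have "(LBINT x:{0..1}. ln (cmod (poly P (c * cis (2 * pi * x)))))
    = (LBINT x:{0..1}. ln (cmod (1 - c / z * cis (2 * pi * x))) + ln (cmod (poly R (c * cis (2 * pi * x)))))"
    by (rule set_lebesgue_integral_cong_AE[OF _ meas meas' eq']) simp
  also have "\<dots> = (LBINT x:{0..1}. ln (cmod (1 - c / z * cis (2 * pi * x)))) + (LBINT x:{0..1}. ln (cmod (poly R (c * cis (2 * pi * x)))))"
    by (rule set_integral_add(2)[OF jensen_factor(1) IH(1)])
  finally have "ln (cmod (poly P 0)) \<le> (LBINT x:{0..1}. ln (cmod (poly P (c * cis (2 * pi * x)))))"
    using IH(2) jensen_factor(2)[of "c / z"] unfolding R0 by linarith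
  with int nz show ?case by blast
qed

section \<open>Periodic integrals and subadditive sequences\<close>

text \<open>Only the fractional part \<open>s\<close> of \<open>t\<close> matters. The window
  \<open>{s..1 + s}\<close> is cut at 1 and its second piece moved back to \<open>{0..s}\<close>;
  the pieces overlap in a null set.\<close>

lemma set_integral_periodic_shift:
  fixes f :: "real \<Rightarrow> real"
  assumes per: "\<And>x. f (x + 1) = f x" and int: "set_integrable lborel {0..1} f"
  shows "set_integrable lborel {0..1} (\<lambda>x. f (x + t))"
    and "(LBINT x:{0..1}. f (x + t)) = (LBINT x:{0..1}. f x)"
proof -
  have per_int: "f (x + of_int n) = f x" for x and n :: int
  proof (induction n rule: int_induct[where k = 0])
    case (step1 i)
    then show ?case using per[of "x + of_int i"] by (simp add: algebra_simps)
  next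
    case (step2 i)
    then show ?case using per[of "x + of_int (i - 1)"] by (simp add: algebra_simps)
  qed simp
  define s where "s = frac t"
  have s: "0 \<le> s" "s < 1" by (auto simp: s_def frac_lt_1)
  have ft: "f (x + t) = f (x + s)" for x
    using per_int[of "x + s" "\<lfloor>t\<rfloor>"] by (simp add: s_def frac_def)
  have i1: "set_integrable lborel {s..1} f" and i0: "set_integrable lborel {0..s} f"
    using int s by (auto intro: set_integrable_subset)
  have shift: "(\<lambda>x. indicator {1..1 + s} (1 + 1 * x) *\<^sub>R f (1 + 1 * x)) = (\<lambda>x. indicator {0..s} x *\<^sub>R f x)"
    using per by (auto simp: fun_eq_iff indicator_def add.commute)
  have i2: "set_integrable lborel {1..1 + s} f"
    using i0 lborel_integrable_real_affine_iff[of 1 "\<lambda>x. indicator {1..1 + s} x *\<^sub>R f x" 1]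
    unfolding set_integrable_def shift by simp
  have v2: "(LBINT x:{1..1 + s}. f x) = (LBINT x:{0..s}. f x)"
    unfolding set_lebesgue_integral_def
    using lborel_integral_real_affine[of 1 "\<lambda>x. indicator {1..1 + s} x *\<^sub>R f x" 1]
    unfolding shift by simp
  have AE1: "AE x in lborel. \<not> (x \<in> {s..1} \<and> x \<in> {1..1 + s})"
    using AE_lborel_singleton[of "1::real"] by eventually_elim auto
  have AE2: "AE x in lborel. \<not> (x \<in> {0..s} \<and> x \<in> {s..1})"
    using AE_lborel_singleton[of s] by eventually_elim auto
  have U1: "{s..1} \<union> {1..1 + s} = {s..1 + s}" and U2: "{0..s} \<union> {s..1} = {0..1}"
    using s by auto
  have i3: "set_integrable lborel {s..1 + s} f"
    using set_integrable_Un[OF i1 i2] unfolding U1 by simp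
  have v3: "(LBINT x:{s..1 + s}. f x) = (LBINT x:{0..1}. f x)"
    using set_integral_Un_AE[OF AE1 _ _ i1 i2] set_integral_Un_AE[OF AE2 _ _ i0 i1]
    unfolding U1 U2 by (simp add: v2)
  have shift': "(\<lambda>x. indicator {s..1 + s} (s + 1 * x) *\<^sub>R f (s + 1 * x)) = (\<lambda>x. indicator {0..1} x *\<^sub>R f (x + s))"
    by (auto simp: fun_eq_iff indicator_def add.commute)
  show "set_integrable lborel {0..1} (\<lambda>x. f (x + t))"
    using i3 lborel_integrable_real_affine_iff[of 1 "\<lambda>x. indicator {s..1 + s} x *\<^sub>R f x" s]
    unfolding set_integrable_def ft shift' by simp
  have "(LBINT x:{s..1 + s}. f x) = (LBINT x:{0..1}. f (x + s))"
    unfolding set_lebesgue_integral_def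
    using lborel_integral_real_affine[of 1 "\<lambda>x. indicator {s..1 + s} x *\<^sub>R f x" s]
    unfolding shift' by simp
  then show "(LBINT x:{0..1}. f (x + t)) = (LBINT x:{0..1}. f x)"
    unfolding ft v3 by simp
qed

text \<open>The substitution \<open>x \<mapsto> 1 - x\<close> preserves the interval, and
  periodicity removes the 1.\<close>

lemma set_integral_periodic_reflect:
  fixes f :: "real \<Rightarrow> real"
  assumes per: "\<And>x. f (x + 1) = f x"
  shows "(LBINT x:{0..1}. f (- x)) = (LBINT x:{0..1}. f x)"
proof -
  have "f (1 - x) = f (- x)" for x using per[of "- x"] by (simp add: algebra_simps)
  then have eq: "(\<lambda>x. indicator {0..1} (1 + - 1 * x) *\<^sub>R f (1 + - 1 * x)) = (\<lambda>x. indicator {0..1} x *\<^sub>R f (- x))"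
    by (auto simp: fun_eq_iff indicator_def)
  show ?thesis
    unfolding set_lebesgue_integral_def
    using lborel_integral_real_affine[of "- 1" "\<lambda>x. indicator {0..1} x *\<^sub>R f x" 1]
    unfolding eq by simp
qed

text \<open>Fekete's lemma, with \<open>v\<close> keeping the infimum finite. Since the limit is the
  infimum, one well chosen \<open>n\<close> bounds it from above.\<close>

lemma subadditive_limit:
  fixes a :: "nat \<Rightarrow> real"
  assumes sub: "\<And>m n. a (m + n) \<le> a m + a n" and lower: "\<And>n. n \<ge> 1 \<Longrightarrow> v \<le> a n / real n"
  obtains L where "(\<lambda>n. a n / real n) \<longlonglongrightarrow> L" "L \<ge> v" "\<And>n. n \<ge> 1 \<Longrightarrow> L \<le> a n / real n"
proof -
  define L where "L = (INF n\<in>{1..}. a n / real n)"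
  have bdd: "bdd_below ((\<lambda>n. a n / real n) ` {1..})"
    using lower by (intro bdd_belowI[of _ v]) auto
  have L_le: "L \<le> a n / real n" if "n \<ge> 1" for n
    unfolding L_def using that by (intro cINF_lower bdd) auto
  have vL: "v \<le> L" unfolding L_def using lower by (intro cINF_greatest) auto
  have mult: "a (q * m + r) \<le> real q * a m + a r" for q m r
  proof (induction q)
    case (Suc q)
    have "a (Suc q * m + r) = a (m + (q * m + r))" by (simp add: add.assoc)
    also have "\<dots> \<le> a m + a (q * m + r)" by (rule sub)
    finally show ?case using Suc by (simp add: algebra_simps)
  qed simp
  have "(\<lambda>n. a n / real n) \<longlonglongrightarrow> L"
  proof (rule LIMSEQ_I)
    fix e :: real assume e: "e > 0"
    have "\<exists>m\<in>{1..}. a m / real m < L + e / 2"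
      using cInf_lessD[of "(\<lambda>n. a n / real n) ` {1..}" "L + e / 2"] e unfolding L_def by auto
    then obtain m where m: "m \<ge> 1" "a m / real m < L + e / 2" by auto
    \<comment> \<open>The remainders modulo the fixed \<open>m\<close> take finitely many values, so
      the error is bounded independently of \<open>n\<close>.\<close>
    define S where "S = (\<Sum>r<m. \<bar>a r\<bar>)"
    define K where "K = S + \<bar>a m\<bar>"
    have K: "K \<ge> 0" by (simp add: K_def S_def sum_nonneg)
    have bound: "a n / real n \<le> a m / real m + 2 * K / real n" if n: "n \<ge> 1" for n
    proof -
      have "a n = a (n div m * m + n mod m)" by simp
      also have "\<dots> \<le> real (n div m) * a m + a (n mod m)" by (rule mult)
      also have "real (n div m) * a m = real n * (a m / real m) - real (n mod m) / real m * a m"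
      proof -
        have "real n = real (n div m) * real m + real (n mod m)"
          by (metis div_mult_mod_eq of_nat_add of_nat_mult)
        then show ?thesis using m by (simp add: field_simps)
      qed
      also have "\<dots> \<le> real n * (a m / real m) + \<bar>a m\<bar>"
      proof -
        have "real (n mod m) / real m \<le> 1" using m by simp
        then have "\<bar>real (n mod m) / real m * a m\<bar> \<le> 1 * \<bar>a m\<bar>"
          unfolding abs_mult by (intro mult_right_mono) auto
        then show ?thesis by linarith
      qed
      also have "a (n mod m) \<le> S"
        unfolding S_def using m member_le_sum[of "n mod m" "{..<m}" "\<lambda>r. \<bar>a r\<bar>"] by fastforce
      finally have "a n \<le> real n * (a m / real m) + \<bar>a m\<bar> + S" by simp
      also have "\<dots> \<le> real n * (a m / real m) + 2 * K"
        using K by (simp add: K_def)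
      finally have "a n \<le> real n * (a m / real m) + 2 * K" .
      then have "a n / real n \<le> (real n * (a m / real m) + 2 * K) / real n"
        using n by (intro divide_right_mono) auto
      then show ?thesis using n by (simp add: add_divide_distrib)
    qed
    obtain N where N: "N \<ge> 1" "2 * K / real N < e / 2"
    proof -
      obtain N where "real N > 4 * K / e" using reals_Archimedean2 by blast
      then have "2 * K / real (N + 1) < e / 2" using e K by (simp add: field_simps)
      then show ?thesis by (intro that[of "N + 1"]) auto
    qed
    show "\<exists>no. \<forall>n\<ge>no. norm (a n / real n - L) < e"
    proof (intro exI allI impI)
      fix n assume n: "n \<ge> N"
      have "2 * K / real n \<le> 2 * K / real N"
        using n N K by (intro divide_left_mono) auto
      then show "norm (a n / real n - L) < e"
        using bound[of n] L_le[of n] n N m by simp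
    qed
  qed
  with vL L_le show ?thesis by (intro that) auto
qed

section \<open>Lyapunov exponents\<close>

lemma opnorm_nonneg: "opnorm A \<ge> 0"
  unfolding opnorm_def by (rule onorm_pos_le) simp

lemma norm_matrix_vector_le: "norm (A *v x) \<le> opnorm A * norm x"
  unfolding opnorm_def by (rule onorm) simp

lemma opnorm_mult: "opnorm (A ** B) \<le> opnorm A * opnorm B"
  unfolding opnorm_def
  using onorm_compose[of "\<lambda>x. A *v x" "\<lambda>x. B *v x"] by (simp add: o_def matrix_vector_mul_assoc)

lemma opnorm_le_entries:
  assumes "\<And>i j. cmod (A $ i $ j) \<le> K"
  shows "opnorm A \<le> 4 * K"
  unfolding opnorm_def
proof (rule onorm_bound)
  show K: "0 \<le> 4 * K" using assms[of 1 1] norm_ge_zero[of "A $ 1 $ 1"] by linarith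
  fix x :: "complex^2"
  have "cmod ((A *v x) $ i) \<le> 2 * (K * norm x)" for i
  proof -
    have "cmod ((A *v x) $ i) \<le> (\<Sum>j\<in>(UNIV :: 2 set). K * norm x)"
      unfolding matrix_vector_mult_def vec_lambda_beta
      by (intro sum_norm_le)
        (auto simp: norm_mult intro!: mult_mono assms Finite_Cartesian_Product.norm_nth_le order_trans[OF norm_ge_zero assms])
    then show ?thesis by simp
  qed
  then have "(\<Sum>i\<in>UNIV. cmod ((A *v x) $ i)) \<le> (\<Sum>i\<in>(UNIV :: 2 set). 2 * (K * norm x))"
    by (intro sum_mono)
  moreover have "norm (A *v x) \<le> (\<Sum>i\<in>UNIV. cmod ((A *v x) $ i))"
    unfolding norm_vec_def by (rule L2_set_le_sum) simp
  ultimately show "norm (A *v x) \<le> 4 * K * norm x" by simp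
qed

lemma opnorm_triangle: "opnorm (A + B) \<le> opnorm A + opnorm B"
  unfolding opnorm_def matrix_vector_mult_add_rdistrib by (rule onorm_triangle) simp_all

lemma continuous_on_opnorm [continuous_intros]:
  assumes "continuous_on S A"
  shows "continuous_on S (\<lambda>x. opnorm (A x))"
proof -
  have "4-lipschitz_on UNIV opnorm"
  proof (rule lipschitz_onI)
    fix A B :: "complex^2^2"
    have le: "opnorm (A - B) \<le> 4 * norm (A - B)" for A B :: "complex^2^2"
      by (intro opnorm_le_entries order_trans[OF Finite_Cartesian_Product.norm_nth_le Finite_Cartesian_Product.norm_nth_le])
    show "dist (opnorm A) (opnorm B) \<le> 4 * dist A B"
      using opnorm_triangle[of "A - B" B] opnorm_triangle[of "B - A" A] le[of A B] le[of B A]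
      by (simp add: dist_norm norm_minus_commute abs_le_iff)
  qed simp
  then have "continuous_on UNIV opnorm" by (rule lipschitz_on_continuous_on)
  then show ?thesis by (rule continuous_on_compose2[OF _ assms]) simp
qed

text \<open>Hadamard's inequality: each column has norm at most \<open>opnorm A\<close>.\<close>

lemma det_le_opnorm: "cmod (det A) \<le> (opnorm A)\<^sup>2"
proof -
  have col: "sqrt ((cmod (A $ 1 $ j))\<^sup>2 + (cmod (A $ 2 $ j))\<^sup>2) \<le> opnorm A" for j
  proof -
    have "norm (axis j 1 :: complex^2) = 1"
      by (simp add: norm_vec_def L2_set_def axis_def if_distrib[of cmod] if_distrib[of "\<lambda>x. x\<^sup>2"] cong: if_cong)
    then have "norm (A *v axis j 1) \<le> opnorm A"
      using norm_matrix_vector_le[of A "axis j 1"] by simp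
    moreover have "(A *v axis j 1) $ i = A $ i $ j" for i
      by (simp add: matrix_vector_mult_def axis_def if_distrib[of "\<lambda>x. _ * x"] cong: if_cong)
    ultimately show ?thesis
      by (simp add: norm_vec_def L2_set_def sum_2)
  qed
  define a b c d where "a = cmod (A $ 1 $ 1)" "b = cmod (A $ 1 $ 2)" "c = cmod (A $ 2 $ 1)" "d = cmod (A $ 2 $ 2)"
  have "cmod (det A) \<le> a * d + b * c"
    unfolding det_2 a_b_c_d_def norm_mult[symmetric] by (rule norm_triangle_ineq4)
  also have "\<dots> \<le> sqrt (a\<^sup>2 + c\<^sup>2) * sqrt (b\<^sup>2 + d\<^sup>2)"
  proof -
    have "(a * d + b * c)\<^sup>2 \<le> (a\<^sup>2 + c\<^sup>2) * (b\<^sup>2 + d\<^sup>2)"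
      using zero_le_power2[of "a * b - c * d"] by (simp add: power2_eq_square algebra_simps)
    then show ?thesis unfolding real_sqrt_mult[symmetric] by (rule real_le_rsqrt)
  qed
  also have "\<dots> \<le> opnorm A * opnorm A"
    using col[of 1] col[of 2] by (intro mult_mono) (auto simp: a_b_c_d_def opnorm_nonneg)
  finally show ?thesis by (simp add: power2_eq_square)
qed

section \<open>Bounds for the exponent of a continuous periodic cocycle\<close>

lemma cocycle_iter_add:
  "cocycle_iter alpha A (m + n) x = cocycle_iter alpha A m (x + real n * alpha) ** cocycle_iter alpha A n x"
  by (induction m) (simp_all add: matrix_mul_assoc algebra_simps)

lemma cocycle_iter_periodic:
  assumes "\<And>x. A (x + 1) = A x"
  shows "cocycle_iter alpha A n (x + 1) = cocycle_iter alpha A n x"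
proof (induction n)
  case (Suc n)
  have "A (x + 1 + real n * alpha) = A (x + real n * alpha)"
    using assms[of "x + real n * alpha"] by (simp add: algebra_simps)
  then show ?case using Suc by simp
qed simp

lemma continuous_on_cocycle_iter:
  assumes "continuous_on UNIV A"
  shows "continuous_on UNIV (cocycle_iter alpha A n)"
proof (induction n)
  case (Suc n)
  have "continuous_on UNIV (\<lambda>x. A (x + real n * alpha))"
    by (rule continuous_on_compose2[OF assms]) (auto intro!: continuous_intros)
  then have "continuous_on UNIV (\<lambda>x. A (x + real n * alpha) ** cocycle_iter alpha A n x)"
    unfolding matrix_matrix_mult_def by (intro continuous_intros Suc)
  then show ?case by simp
qed simp

text \<open>Half of \<open>ln (cmod (det X))\<close> lies below \<open>ln (opnorm X)\<close>. This
  gives the lower bound and, with an upper bound from compactness, integrability. Where the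
  determinant is nonzero all norms are positive, so the logarithms are subadditive.\<close>

lemma lyap_bounds:
  assumes cont: "continuous_on UNIV A" and per: "\<And>x. A (x + 1) = A x"
    and det_int: "\<And>n. set_integrable lborel {0..1} (\<lambda>x. ln (cmod (det (cocycle_iter alpha A n x))))"
    and det_ge: "\<And>n. real n * (2 * v) \<le> (LBINT x:{0..1}. ln (cmod (det (cocycle_iter alpha A n x))))"
    and det_nz: "\<And>n. AE x in lborel. det (cocycle_iter alpha A n x) \<noteq> 0"
  shows "v \<le> lyap alpha A"
    and "\<And>n w. n \<ge> 1 \<Longrightarrow> (\<And>x. opnorm (cocycle_iter alpha A n x) \<le> exp (real n * w)) \<Longrightarrow> lyap alpha A \<le> w"
proof -
  define f where "f n x = ln (opnorm (cocycle_iter alpha A n x))" for n x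
  define D where "D n x = ln (cmod (det (cocycle_iter alpha A n x)))" for n x
  have pos: "opnorm (cocycle_iter alpha A n x) > 0" and f_ge: "D n x / 2 \<le> f n x"
    if nz: "det (cocycle_iter alpha A n x) \<noteq> 0" for n x
  proof -
    let ?X = "cocycle_iter alpha A n x"
    have "0 < cmod (det ?X)" using nz by simp
    then have "0 < (opnorm ?X)\<^sup>2" using det_le_opnorm[of ?X] by linarith
    then show p: "opnorm ?X > 0" using opnorm_nonneg[of ?X] by (simp add: less_eq_real_def)
    have "ln (cmod (det ?X)) \<le> ln ((opnorm ?X)\<^sup>2)"
      using nz p det_le_opnorm[of ?X] by (subst ln_le_cancel_iff) auto
    also have "\<dots> = 2 * ln (opnorm ?X)" using p by (simp add: ln_realpow)
    finally show "D n x / 2 \<le> f n x" by (simp add: D_def f_def)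
  qed
  have contn: "continuous_on UNIV (\<lambda>x. opnorm (cocycle_iter alpha A n x))" for n
    by (intro continuous_intros continuous_on_cocycle_iter cont)
  have meas: "f n \<in> borel_measurable borel" for n
    unfolding f_def by (intro borel_measurable_ln borel_measurable_continuous_onI contn)
  have int: "set_integrable lborel {0..1} (f n)" for n
  proof -
    have "compact ((\<lambda>x. opnorm (cocycle_iter alpha A n x)) ` {0..1})"
      by (intro compact_continuous_image continuous_on_subset[OF contn]) auto
    then obtain K where K: "\<And>x. x \<in> {0..1} \<Longrightarrow> opnorm (cocycle_iter alpha A n x) \<le> K"
      by (meson bdd_above.E bounded_imp_bdd_above compact_imp_bounded image_eqI)
    \<comment> \<open>With a bound of at least 1, \<open>ln K'\<close> is nonnegative and
      \<open>ln K' + \<bar>D n x\<bar>\<close> dominates \<open>f n\<close> from both sides.\<close>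
    define K' where "K' = max K 1"
    have c: "set_integrable lborel {0..1::real} (\<lambda>x. ln K')"
      by (intro borel_integrable_atLeastAtMost') auto
    have g: "set_integrable lborel {0..1} (\<lambda>x. ln K' + \<bar>D n x\<bar>)"
      unfolding D_def by (intro set_integral_add c set_integrable_abs det_int)
    show ?thesis
    proof (rule set_integrable_bound[OF g])
      show "set_borel_measurable lborel {0..1} (f n)"
        using meas unfolding set_borel_measurable_def by measurable
      show "AE x in lborel. x \<in> {0..1} \<longrightarrow> norm (f n x) \<le> norm (ln K' + \<bar>D n x\<bar>)"
        using det_nz[of n]
      proof eventually_elim
        case (elim x)
        show ?case
        proof
          assume x: "x \<in> {0..1}"
          have "opnorm (cocycle_iter alpha A n x) \<le> K'" using K[OF x] by (simp add: K'_def)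
          then have "f n x \<le> ln K'" unfolding f_def using pos[OF elim] by simp
          moreover have "ln K' \<ge> 0" by (simp add: K'_def)
          ultimately show "norm (f n x) \<le> norm (ln K' + \<bar>D n x\<bar>)" using f_ge[OF elim] by simp
        qed
      qed
    qed
  qed
  define a where "a n = (LBINT x:{0..1}. f n x)" for n
  have fper: "f n (x + 1) = f n x" for n x
    by (simp add: f_def cocycle_iter_periodic[where A = A, OF per])
  have sub: "a (m + n) \<le> a m + a n" for m n
  proof -
    note sh = set_integral_periodic_shift[of "f m" "real n * alpha", OF fper int]
    have "a (m + n) \<le> (LBINT x:{0..1}. f m (x + real n * alpha) + f n x)"
      unfolding a_def
    proof (rule set_integral_mono_AE[OF int])
      show "set_integrable lborel {0..1} (\<lambda>x. f m (x + real n * alpha) + f n x)"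
        by (rule set_integral_add(1)[OF sh(1) int])
      show "AE x\<in>{0..1} in lborel. f (m + n) x \<le> f m (x + real n * alpha) + f n x"
        using det_nz[of "m + n"]
      proof eventually_elim
        case (elim x)
        let ?X = "cocycle_iter alpha A m (x + real n * alpha)" and ?Y = "cocycle_iter alpha A n x"
        have nz: "det ?X \<noteq> 0" "det ?Y \<noteq> 0" using elim by (auto simp: cocycle_iter_add det_mul)
        have "f (m + n) x \<le> ln (opnorm ?X * opnorm ?Y)"
          unfolding f_def using pos[OF elim] pos[OF nz(1)] pos[OF nz(2)] opnorm_mult[of ?X ?Y]
          by (subst ln_le_cancel_iff) (auto simp: cocycle_iter_add)
        also have "\<dots> = f m (x + real n * alpha) + f n x"
          unfolding f_def using pos[OF nz(1)] pos[OF nz(2)] by (simp add: ln_mult)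
        finally show ?case by simp
      qed
    qed
    also have "\<dots> = a m + a n"
      unfolding a_def using set_integral_add(2)[OF sh(1) int] sh(2) by simp
    finally show ?thesis .
  qed
  have lower: "v \<le> a n / real n" if "n \<ge> 1" for n
  proof -
    have "(LBINT x:{0..1}. D n x / 2) \<le> a n"
      unfolding a_def
    proof (rule set_integral_mono_AE[OF _ int])
      show "set_integrable lborel {0..1} (\<lambda>x. D n x / 2)"
        using det_int[of n] by (simp add: D_def)
      show "AE x\<in>{0..1} in lborel. D n x / 2 \<le> f n x"
        using det_nz[of n] by eventually_elim (blast intro: f_ge)
    qed
    moreover have "(LBINT x:{0..1}. D n x / 2) = (LBINT x:{0..1}. D n x) / 2" by simp
    ultimately have "real n * v \<le> a n" using det_ge[of n] unfolding D_def by linarith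
    then show ?thesis using that by (simp add: field_simps)
  qed
  obtain L where L: "(\<lambda>n. a n / real n) \<longlonglongrightarrow> L" "L \<ge> v" "\<And>n. n \<ge> 1 \<Longrightarrow> L \<le> a n / real n"
    using subadditive_limit[OF sub lower] by blast
  have lyap: "lyap alpha A = L"
    unfolding lyap_def using L(1) by (intro limI) (simp add: a_def f_def)
  show "v \<le> lyap alpha A" using L(2) lyap by simp
  fix n w assume n: "n \<ge> 1" and w: "\<And>x. opnorm (cocycle_iter alpha A n x) \<le> exp (real n * w)"
  have c: "set_integrable lborel {0..1::real} (\<lambda>x. real n * w)"
    by (intro borel_integrable_atLeastAtMost') auto
  have "a n \<le> (LBINT x:{0..1::real}. real n * w)"
    unfolding a_def
  proof (rule set_integral_mono_AE[OF int c])
    show "AE x\<in>{0..1} in lborel. f n x \<le> real n * w"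
      using det_nz[of n]
    proof eventually_elim
      case (elim x)
      have "ln (opnorm (cocycle_iter alpha A n x)) \<le> ln (exp (real n * w))"
        using pos[OF elim] w[of x] by (subst ln_le_cancel_iff) auto
      then show ?case by (simp add: f_def)
    qed
  qed
  also have "\<dots> = real n * w" by (simp add: set_lebesgue_integral_def)
  finally have "a n / real n \<le> w" using n by (simp add: field_simps)
  then show "lyap alpha A \<le> w" using L(3)[OF n] lyap by simp
qed

section \<open>The Jacobi cocycle\<close>

lemma exp_power_split:
  assumes "m \<le> k"
  shows "exp (of_int k * y :: complex) = exp (of_int m * y) * exp y ^ nat (k - m)"
proof -
  have "exp y ^ nat (k - m) = exp (of_nat (nat (k - m)) * y)" by (rule exp_of_nat_mult[symmetric])
  also have "of_nat (nat (k - m)) = (of_int k - of_int m :: complex)" using assms by (simp add: of_nat_nat)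
  finally show ?thesis by (simp add: exp_add[symmetric] algebra_simps)
qed

lemma mat2_nth [simp]:
  "mat2 a b c d $ 1 $ 1 = a" "mat2 a b c d $ 1 $ 2 = b"
  "mat2 a b c d $ 2 $ 1 = c" "mat2 a b c d $ 2 $ 2 = d"
  by (simp_all add: mat2_def)

text \<open>The assumptions are stable under the reflection of all frequencies together with
  \<open>alpha\<close>, so the locale can be interpreted for both signs of
  \<open>eps\<close>.\<close>

locale jacobi =
  fixes alpha :: real and M :: nat and lam :: "int \<Rightarrow> complex"
    and N1 N2 :: int and mu :: "int \<Rightarrow> complex" and E :: real
  assumes irr: "alpha \<notin> \<rat>" and N12: "N1 < N2"
    and mu1: "mu N1 \<noteq> 0" and mu2: "mu N2 \<noteq> 0" and gap: "N2 - N1 > 2 * int M"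
begin

abbreviation J :: "real \<Rightarrow> real \<Rightarrow> complex^2^2" where
  "J eps \<equiv> jacobi_cocycle M lam N1 N2 mu alpha E eps"

text \<open>Here \<open>eps\<close> carries its sign: this value is a lower bound for every
  \<open>eps\<close> and is attained for large positive ones.\<close>

definition rate :: "real \<Rightarrow> real" where
  "rate eps = pi * real_of_int (N2 - N1) * eps + (ln (cmod (mu N1)) + ln (cmod (mu N2))) / 2"

text \<open>\<open>b_poly\<close> and \<open>a_poly\<close> are what remains of \<open>c\<close> and
  of the shifted \<open>trig_ct\<close> in the variable \<open>exp (2 pi i z)\<close> after their
  lowest powers, of orders \<open>N1\<close> and \<open>- N2\<close>, are split off; the phases in
  \<open>a_poly\<close> come from the shift by \<open>alpha\<close>.\<close>

definition b_poly :: "complex poly" where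
  "b_poly = (\<Sum>k\<in>{N1..N2}. monom (mu k) (nat (k - N1)))"

definition a_poly :: "complex poly" where
  "a_poly = (\<Sum>k\<in>{N1..N2}. monom (cnj (mu k) * cis (2 * pi * of_int k * alpha)) (nat (N2 - k)))"

section \<open>Laurent factorisation of the entries and the determinant\<close>

lemma trig_c_eq: "trig_c N1 N2 mu z = exp (of_int N1 * (2 * pi * \<i> * z)) * poly b_poly (exp (2 * pi * \<i> * z))"
proof -
  have "exp (2 * pi * \<i> * of_int k * z) = exp (of_int N1 * (2 * pi * \<i> * z)) * exp (2 * pi * \<i> * z) ^ nat (k - N1)"
    if "k \<in> {N1..N2}" for k
    using exp_power_split[of N1 k "2 * pi * \<i> * z"] that by (simp add: mult_ac)
  then show ?thesis
    unfolding trig_c_def b_poly_def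
    by (simp add: poly_sum poly_monom sum_distrib_left mult.left_commute)
qed

lemma trig_ct_eq:
  "trig_ct N1 N2 mu (z - complex_of_real alpha)
    = exp (of_int (- N2) * (2 * pi * \<i> * z)) * poly a_poly (exp (2 * pi * \<i> * z))"
proof -
  have "exp (- (2 * pi * \<i> * of_int k * (z - complex_of_real alpha)))
    = cis (2 * pi * of_int k * alpha) * (exp (of_int (- N2) * (2 * pi * \<i> * z)) * exp (2 * pi * \<i> * z) ^ nat (N2 - k))"
    if "k \<in> {N1..N2}" for k
  proof -
    have "exp (- (2 * pi * \<i> * of_int k * (z - complex_of_real alpha)))
      = cis (2 * pi * of_int k * alpha) * exp (of_int (- k) * (2 * pi * \<i> * z))"
      by (simp add: cis_conv_exp exp_add[symmetric] algebra_simps)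
    also have "exp (of_int (- k) * (2 * pi * \<i> * z))
      = exp (of_int (- N2) * (2 * pi * \<i> * z)) * exp (2 * pi * \<i> * z) ^ nat (N2 - k)"
      using exp_power_split[of "- N2" "- k" "2 * pi * \<i> * z"] that by simp
    finally show ?thesis .
  qed
  then show ?thesis
    unfolding trig_ct_def a_poly_def
    by (simp add: poly_sum poly_monom sum_distrib_left mult_ac)
qed

lemma poly_b_0: "poly b_poly 0 = mu N1"
proof -
  have "poly b_poly 0 = (\<Sum>k\<in>{N1..N2}. if k = N1 then mu N1 else 0)"
    unfolding b_poly_def poly_sum poly_monom by (intro sum.cong) auto
  then show ?thesis using N12 by simp
qed

lemma cmod_poly_a_0: "cmod (poly a_poly 0) = cmod (mu N2)"
proof -
  have "poly a_poly 0 = (\<Sum>k\<in>{N1..N2}. if k = N2 then cnj (mu N2) * cis (2 * pi * of_int N2 * alpha) else 0)"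
    unfolding a_poly_def poly_sum poly_monom by (intro sum.cong) auto
  then show ?thesis using N12 by (simp add: norm_mult)
qed

lemma exp_2_pi_Complex: "exp (2 * pi * \<i> * Complex x eps) = of_real (exp (- 2 * pi * eps)) * cis (2 * pi * x)"
  by (simp add: exp_eq_polar complex_eq_iff cis.sel algebra_simps)

lemma det_J:
  "cmod (det (J eps x)) = exp (2 * pi * eps * of_int (N2 - N1))
    * cmod (poly (b_poly * a_poly) (of_real (exp (- 2 * pi * eps)) * cis (2 * pi * x)))"
proof -
  let ?y = "2 * pi * \<i> * Complex x eps"
  have "det (J eps x) = trig_c N1 N2 mu (Complex x eps) * trig_ct N1 N2 mu (Complex x eps - complex_of_real alpha)"
    by (simp add: det_2 jacobi_cocycle_def)
  also have "\<dots> = exp (of_int N1 * ?y) * exp (of_int (- N2) * ?y) * poly (b_poly * a_poly) (exp ?y)"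
    unfolding trig_c_eq trig_ct_eq by simp
  also have "exp (of_int N1 * ?y) * exp (of_int (- N2) * ?y) = exp (of_int (N1 - N2) * ?y)"
    by (simp add: exp_add[symmetric] algebra_simps)
  finally have "cmod (det (J eps x)) = cmod (exp (of_int (N1 - N2) * ?y)) * cmod (poly (b_poly * a_poly) (exp ?y))"
    by (simp only: norm_mult)
  also have "cmod (exp (of_int (N1 - N2) * ?y)) = exp (2 * pi * eps * of_int (N2 - N1))"
    by (simp add: norm_exp_eq_Re algebra_simps)
  finally show ?thesis unfolding exp_2_pi_Complex .
qed

text \<open>In modulus, the determinant of one step is a constant times a polynomial on a circle.
  Rotations fix the origin, so each step multiplies the value there by
  \<open>exp (2 * rate eps)\<close> in modulus; this is the value that Jensen's inequality
  uses.\<close>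

lemma det_cocycle:
  obtains P where "\<And>x. cmod (det (cocycle_iter alpha (J eps) n x))
      = cmod (poly P (of_real (exp (- 2 * pi * eps)) * cis (2 * pi * x)))"
    "cmod (poly P 0) = exp (real n * (2 * rate eps))"
proof -
  have "\<exists>P. (\<forall>x. cmod (det (cocycle_iter alpha (J eps) n x))
      = cmod (poly P (of_real (exp (- 2 * pi * eps)) * cis (2 * pi * x))))
    \<and> cmod (poly P 0) = exp (real n * (2 * rate eps))"
  proof (induction n)
    case 0
    show ?case by (intro exI[of _ 1]) simp
  next
    case (Suc n)
    then obtain P where P: "\<And>x. cmod (det (cocycle_iter alpha (J eps) n x))
        = cmod (poly P (of_real (exp (- 2 * pi * eps)) * cis (2 * pi * x)))"
      "cmod (poly P 0) = exp (real n * (2 * rate eps))" by blast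
    define Q where "Q = smult (of_real (exp (2 * pi * eps * of_int (N2 - N1))))
      (pcompose (b_poly * a_poly) [:0, cis (2 * pi * (real n * alpha)):]) * P"
    have "cmod (det (cocycle_iter alpha (J eps) (Suc n) x))
        = cmod (poly Q (of_real (exp (- 2 * pi * eps)) * cis (2 * pi * x)))" for x
    proof -
      have "cis (2 * pi * (x + real n * alpha)) = cis (2 * pi * x) * cis (2 * pi * (real n * alpha))"
        by (simp add: cis_mult algebra_simps)
      then show ?thesis
        by (simp add: det_mul norm_mult P det_J Q_def poly_pcompose mult.assoc)
    qed
    moreover have "cmod (poly Q 0) = exp (real (Suc n) * (2 * rate eps))"
    proof -
      have "cmod (poly Q 0) = exp (2 * pi * eps * of_int (N2 - N1)) * (cmod (mu N1) * cmod (mu N2)) * exp (real n * (2 * rate eps))"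
        by (simp add: Q_def poly_pcompose norm_mult poly_b_0 cmod_poly_a_0 P)
      also have "cmod (mu N1) * cmod (mu N2) = exp (ln (cmod (mu N1)) + ln (cmod (mu N2)))"
        using mu1 mu2 by (simp add: exp_add)
      finally show ?thesis
        by (simp add: rate_def exp_add[symmetric] algebra_simps)
    qed
    ultimately show ?case by blast
  qed
  then show ?thesis using that by blast
qed

lemma J_periodic: "J eps (x + 1) = J eps x"
proof -
  have *: "exp (2 * pi * \<i> * Complex (x + 1) eps) = exp (2 * pi * \<i> * Complex x eps)"
    unfolding exp_2_pi_Complex by (simp add: ring_distribs flip: cis_mult)
  have i: "exp (of_int k * (2 * pi * \<i> * Complex (x + 1) eps)) = exp (of_int k * (2 * pi * \<i> * Complex x eps))" for k
    unfolding exp_power_int[symmetric] * ..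
  have "trig_v M lam (Complex (x + 1) eps) = trig_v M lam (Complex x eps)"
    unfolding trig_v_def using i by (intro sum.cong refl arg_cong2[where f = times]) (simp add: mult_ac)
  then show ?thesis
    unfolding jacobi_cocycle_def trig_c_eq trig_ct_eq * i by simp
qed

lemma continuous_J: "continuous_on UNIV (J eps)"
proof -
  have C: "(\<lambda>x. Complex x eps) = (\<lambda>x. of_real x + \<i> * of_real eps)"
    by (auto simp: complex_eq_iff)
  have c: "continuous_on UNIV (\<lambda>x. Complex x eps)" unfolding C by (intro continuous_intros)
  have "continuous_on UNIV (\<lambda>x. J eps x $ i $ j)" for i j :: 2
    using exhaust_2[of i] exhaust_2[of j]
    by (elim disjE; simp add: jacobi_cocycle_def trig_v_def trig_c_def trig_ct_def; intro continuous_intros c)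
  then have "continuous_on UNIV (\<lambda>x. \<chi> i j. J eps x $ i $ j)"
    by (intro continuous_on_vec_lambda)
  then show ?thesis by simp
qed

lemma det_J_integral:
  shows "set_integrable lborel {0..1} (\<lambda>x. ln (cmod (det (cocycle_iter alpha (J eps) n x))))"
    and "real n * (2 * rate eps) \<le> (LBINT x:{0..1}. ln (cmod (det (cocycle_iter alpha (J eps) n x))))"
    and "AE x in lborel. det (cocycle_iter alpha (J eps) n x) \<noteq> 0"
proof -
  obtain P where P: "\<And>x. cmod (det (cocycle_iter alpha (J eps) n x))
      = cmod (poly P (of_real (exp (- 2 * pi * eps)) * cis (2 * pi * x)))"
    "cmod (poly P 0) = exp (real n * (2 * rate eps))" using det_cocycle[of eps n] by blast
  have nz: "poly P 0 \<noteq> 0" using P(2) by auto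
  note jp = jensen_poly[OF nz, of "of_real (exp (- 2 * pi * eps))"]
  show "set_integrable lborel {0..1} (\<lambda>x. ln (cmod (det (cocycle_iter alpha (J eps) n x))))"
    and "real n * (2 * rate eps) \<le> (LBINT x:{0..1}. ln (cmod (det (cocycle_iter alpha (J eps) n x))))"
    using jp unfolding P by (auto simp: P(2))
  have "det (cocycle_iter alpha (J eps) n x) \<noteq> 0
      \<longleftrightarrow> poly P (of_real (exp (- 2 * pi * eps)) * cis (2 * pi * x)) \<noteq> 0" for x
    using P(1)[of x] by (metis norm_eq_zero)
  then show "AE x in lborel. det (cocycle_iter alpha (J eps) n x) \<noteq> 0" using jp by simp
qed

lemmas lyap_ge = lyap_bounds(1)[OF continuous_J J_periodic det_J_integral]
lemmas lyap_le = lyap_bounds(2)[OF continuous_J J_periodic det_J_integral]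

subsection \<open>The renormalised cocycle\<close>

definition d :: nat where "d = nat (N2 - N1)"

definition kap :: complex where "kap = cis (pi * alpha)"

text \<open>A square root of \<open>exp (2 pi i z)\<close>, since the normalising power has exponent
  \<open>(N2 - N1) / 2\<close>, possibly a half-integer. One step multiplies it by
  \<open>kap\<close>.\<close>

definition u :: "real \<Rightarrow> real \<Rightarrow> complex" where "u eps x = exp (pi * \<i> * Complex x eps)"

text \<open>The diagonal of the conjugating matrix. After multiplication by \<open>u ^ d\<close> the
  off-diagonal entries carry the opposite powers \<open>N1 + N2\<close> and
  \<open>- (N1 + N2)\<close> of \<open>u\<close>, which this conjugation removes.\<close>

definition dd :: "2 \<Rightarrow> complex \<Rightarrow> complex" where
  "dd i t = (if i = 1 then t powi (N1 + N2) else 1)"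

text \<open>This is \<open>u ^ d * (E - v)\<close>; the gap condition makes all exponents positive,
  so it is a polynomial vanishing at 0.\<close>

definition e_poly :: "complex poly" where
  "e_poly = monom (of_real E) d - (\<Sum>j\<in>{-int M..int M} - {0}. monom (lam j) (nat (N2 - N1 + 2 * j)))"

definition G :: "2 \<Rightarrow> 2 \<Rightarrow> complex poly" where
  "G i j = (if i = 1
     then if j = 1 then smult (kap powi (N1 + N2)) e_poly
          else smult (- (kap powi (N1 + N2))) (pcompose a_poly (monom 1 2))
     else if j = 1 then pcompose b_poly (monom 1 2) else 0)"

lemma dd_nz: "t \<noteq> 0 \<Longrightarrow> dd i t \<noteq> 0"
  by (simp add: dd_def)

lemma kap_nz [simp]: "kap \<noteq> 0"
  by (simp add: kap_def)

lemma u_nz [simp]: "u eps x \<noteq> 0"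
  by (simp add: u_def)

lemma cmod_u: "cmod (u eps x) = exp (- pi * eps)"
  by (simp add: u_def norm_exp_eq_Re)

lemma u_shift: "u eps (x + real k * alpha) = kap ^ k * u eps x"
proof -
  have "kap ^ k = cis (real k * (pi * alpha))"
    by (simp only: kap_def Complex.DeMoivre)
  then have "kap ^ k = exp (\<i> * (pi * (real k * alpha)))"
    by (simp add: cis_conv_exp mult_ac)
  moreover have "Complex (x + real k * alpha) eps = Complex x eps + of_real (real k * alpha)"
    by (simp add: complex_eq_iff)
  ultimately show ?thesis by (simp add: u_def exp_add[symmetric] algebra_simps)
qed

text \<open>The left conjugator is taken at the next orbit point \<open>kap * u\<close>, so that it
  cancels against the right conjugator of the following factor.\<close>

lemma J_entry:
  "J eps x $ i $ j = inverse (u eps x ^ d) * inverse (dd i (kap * u eps x)) * poly (G i j) (u eps x) * dd j (u eps x)"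
proof -
  let ?z = "Complex x eps"
  define y where "y = pi * \<i> * ?z"
  define U where "U = u eps x"
  have U: "U = exp y" by (simp add: U_def u_def y_def)
  have U_nz: "U \<noteq> 0" by (simp add: U)
  have y2: "2 * pi * \<i> * ?z = 2 * y" by (simp add: y_def)
  have E2: "exp (2 * y) = U\<^sup>2" by (simp add: U exp_double)
  have Ud: "U ^ d = exp (of_int (N2 - N1) * y)"
    using N12 by (simp add: U d_def exp_of_nat_mult[symmetric] of_nat_nat)
  have Up: "U powi (N1 + N2) = exp (of_int (N1 + N2) * y)"
    by (simp only: U exp_power_int)
  have kU: "(kap * U) powi (N1 + N2) = kap powi (N1 + N2) * U powi (N1 + N2)"
    by (rule power_int_mult_distrib)
  have v: "U ^ d * trig_v M lam ?z = (\<Sum>j\<in>{-int M..int M} - {0}. lam j * U ^ nat (N2 - N1 + 2 * j))"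
  proof -
    have "U ^ d * exp (2 * pi * \<i> * of_int j * ?z) = U ^ nat (N2 - N1 + 2 * j)"
      if "j \<in> {-int M..int M} - {0}" for j
    proof -
      have nn: "N2 - N1 + 2 * j \<ge> 0" using that gap by auto
      have "exp (2 * pi * \<i> * of_int j * ?z) = exp (of_int (2 * j) * y)" by (simp add: y_def mult_ac)
      then have "U ^ d * exp (2 * pi * \<i> * of_int j * ?z) = exp (of_int (N2 - N1 + 2 * j) * y)"
        by (simp add: Ud exp_add[symmetric] algebra_simps)
      also have "of_int (N2 - N1 + 2 * j) = (of_nat (nat (N2 - N1 + 2 * j)) :: complex)"
        using nn by (simp only: of_nat_nat)
      finally show ?thesis by (simp only: exp_of_nat_mult U)
    qed
    then have "lam j * (U ^ d * exp (2 * pi * \<i> * of_int j * ?z)) = lam j * U ^ nat (N2 - N1 + 2 * j)"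
      if "j \<in> {-int M..int M} - {0}" for j
      using that by simp
    then show ?thesis
      unfolding trig_v_def sum_distrib_left by (intro sum.cong) (auto simp: mult.left_commute)
  qed
  have e: "poly e_poly U = U ^ d * (of_real E - trig_v M lam ?z)"
    unfolding right_diff_distrib v by (simp add: e_poly_def poly_sum poly_monom)
  have c: "trig_c N1 N2 mu ?z * U ^ d = poly b_poly (U\<^sup>2) * U powi (N1 + N2)"
  proof -
    have "exp (of_int N1 * (2 * y)) * U ^ d = U powi (N1 + N2)"
      unfolding Ud Up by (simp add: exp_add[symmetric] algebra_simps)
    then show ?thesis unfolding trig_c_eq y2 E2 by (metis mult.assoc mult.commute)
  qed
  have ct: "trig_ct N1 N2 mu (?z - complex_of_real alpha) * (U ^ d * U powi (N1 + N2)) = poly a_poly (U\<^sup>2)"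
  proof -
    have "exp (of_int (- N2) * (2 * y)) * (U ^ d * U powi (N1 + N2)) = 1"
      unfolding Ud Up by (simp add: exp_add[symmetric] algebra_simps)
    then show ?thesis unfolding trig_ct_eq y2 E2 by (metis mult.assoc mult.commute mult_1)
  qed
  have nz: "U ^ d \<noteq> 0" "U powi (N1 + N2) \<noteq> 0" "kap powi (N1 + N2) \<noteq> 0" using U_nz by auto
  have J: "J eps x = mat2 (of_real E - trig_v M lam ?z) (- trig_ct N1 N2 mu (?z - complex_of_real alpha)) (trig_c N1 N2 mu ?z) 0"
    by (simp add: jacobi_cocycle_def)
  have "of_real E - trig_v M lam ?z = inverse (U ^ d) * inverse (kap powi (N1 + N2) * U powi (N1 + N2))
      * (kap powi (N1 + N2) * (U ^ d * (of_real E - trig_v M lam ?z))) * U powi (N1 + N2)"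
    using nz U_nz by (simp add: divide_simps)
  moreover have "- trig_ct N1 N2 mu (?z - complex_of_real alpha)
      = inverse (U ^ d) * inverse (kap powi (N1 + N2) * U powi (N1 + N2)) * (- (kap powi (N1 + N2)) * poly a_poly (U\<^sup>2))"
    unfolding ct[symmetric] using nz U_nz by (simp add: divide_simps)
  moreover have "trig_c N1 N2 mu ?z = inverse (U ^ d) * (poly b_poly (U\<^sup>2) * U powi (N1 + N2))"
    unfolding c[symmetric] using nz U_nz by (simp add: divide_simps)
  ultimately have "J eps x $ i $ j = inverse (U ^ d) * inverse (dd i (kap * U)) * poly (G i j) U * dd j U"
    unfolding J using exhaust_2[of i] exhaust_2[of j]
    by (elim disjE; simp add: dd_def G_def kU poly_pcompose poly_monom e)
  then show ?thesis by (simp add: U_def)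
qed

text \<open>The product of the two antidiagonal entries of \<open>G\<close> at 0, so that the square
  of this matrix is \<open>scal\<close> times the identity. Dividing by it normalises the two-step
  matrix \<open>B\<close>.\<close>

definition scal :: complex where
  "scal = - (kap powi (N1 + N2)) * poly a_poly 0 * poly b_poly 0"

definition B :: "2 \<Rightarrow> 2 \<Rightarrow> complex poly" where
  "B i l = smult (1 / scal) (\<Sum>m\<in>UNIV. pcompose (G i m) [:0, kap:] * G m l)"

lemma cmod_scal: "cmod scal = cmod (mu N1) * cmod (mu N2)"
  by (simp add: scal_def norm_mult norm_power_int kap_def poly_b_0 cmod_poly_a_0)

lemma scal_nz: "scal \<noteq> 0"
  using cmod_scal mu1 mu2 by (metis mult_eq_0_iff norm_eq_zero)

lemma poly_e_0: "poly e_poly 0 = 0"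
proof -
  have "lam j * 0 ^ nat (N2 - N1 + 2 * j) = 0" if "j \<in> {-int M..int M} - {0}" for j
    using that gap by auto
  then have "(\<Sum>j\<in>{-int M..int M} - {0}. lam j * 0 ^ nat (N2 - N1 + 2 * j)) = 0"
    by (rule sum.neutral[OF ballI])
  then show ?thesis
    using N12 by (simp add: e_poly_def poly_sum poly_monom d_def)
qed

lemma coeff_B_0: "coeff (B i l) 0 = (if i = l then 1 else 0)"
proof -
  have "poly (B i l) 0 = (if i = l then 1 else 0)"
    using exhaust_2[of i] exhaust_2[of l] scal_nz
    by (auto simp: B_def sum_2 poly_pcompose G_def poly_e_0 poly_monom scal_def)
  then show ?thesis by (simp add: poly_0_coeff_0)
qed

lemma J_mult_entry:
  assumes M: "\<And>i j. X $ i $ j = c * inverse (dd i (u eps y)) * g i j * t j"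
  shows "(J eps y ** X) $ i $ j
    = (inverse (u eps y ^ d) * c) * inverse (dd i (kap * u eps y)) * (\<Sum>m\<in>UNIV. poly (G i m) (u eps y) * g m j) * t j"
proof -
  have "(J eps y ** X) $ i $ j = (\<Sum>m\<in>UNIV. J eps y $ i $ m * X $ m $ j)"
    by (simp add: matrix_matrix_mult_def)
  also have "\<dots> = (\<Sum>m\<in>UNIV. (inverse (u eps y ^ d) * c) * inverse (dd i (kap * u eps y)) * (poly (G i m) (u eps y) * g m j) * t j)"
  proof (rule sum.cong)
    fix m
    have "dd m (u eps y) * inverse (dd m (u eps y)) = 1" using dd_nz[of "u eps y" m] by simp
    then show "J eps y $ i $ m * X $ m $ j
      = (inverse (u eps y ^ d) * c) * inverse (dd i (kap * u eps y)) * (poly (G i m) (u eps y) * g m j) * t j"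
      unfolding J_entry M by algebra
  qed simp
  finally show ?thesis by (simp add: sum_distrib_left sum_distrib_right)
qed

lemma kap_sq: "kap\<^sup>2 = cis (2 * pi * alpha)"
  by (simp add: kap_def Complex.DeMoivre mult.assoc)

text \<open>The conjugators telescope, leaving only those at both ends. The scalar factor has
  modulus independent of \<open>x\<close>: two steps contribute
  \<open>cmod (u eps x) ^ (- 2 d) * cmod scal\<close>, which is
  \<open>exp (2 * rate eps)\<close>.\<close>

lemma cocycle_entry:
  "\<exists>c. cmod c = exp (real n * (2 * rate eps)) \<and>
    (\<forall>i j. cocycle_iter alpha (J eps) (2 * n) x $ i $ j
      = c * inverse (dd i ((kap\<^sup>2) ^ n * u eps x)) * poly (orbit_poly (kap\<^sup>2) B n i j) (u eps x) * dd j (u eps x))"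
proof (induction n)
  case 0
  have "inverse (dd i (u eps x)) * dd i (u eps x) = 1" for i using dd_nz[of "u eps x" i] by simp
  then show ?case by (intro exI[of _ 1]) (simp add: mat_def)
next
  case (Suc n)
  then obtain c where c: "cmod c = exp (real n * (2 * rate eps))"
    "\<And>i j. cocycle_iter alpha (J eps) (2 * n) x $ i $ j
      = c * inverse (dd i ((kap\<^sup>2) ^ n * u eps x)) * poly (orbit_poly (kap\<^sup>2) B n i j) (u eps x) * dd j (u eps x)"
    by blast
  define g where "g i j = poly (orbit_poly (kap\<^sup>2) B n i j) (u eps x)" for i j
  define y0 where "y0 = x + real (2 * n) * alpha"
  define y1 where "y1 = x + real (Suc (2 * n)) * alpha"
  have y0: "u eps y0 = (kap\<^sup>2) ^ n * u eps x"
    unfolding y0_def u_shift by (simp add: power_mult)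
  have y1: "u eps y1 = kap * u eps y0"
    unfolding y0_def y1_def u_shift by (simp only: power_Suc mult.assoc)
  have X0: "cocycle_iter alpha (J eps) (2 * n) x $ i $ j = c * inverse (dd i (u eps y0)) * g i j * dd j (u eps x)" for i j
    unfolding c(2) y0 g_def ..
  define h where "h i j = (\<Sum>m\<in>UNIV. poly (G i m) (u eps y0) * g m j)" for i j
  have X1: "(J eps y0 ** cocycle_iter alpha (J eps) (2 * n) x) $ i $ j
    = (inverse (u eps y0 ^ d) * c) * inverse (dd i (u eps y1)) * h i j * dd j (u eps x)" for i j
    unfolding y1 h_def by (rule J_mult_entry[OF X0])
  have X2: "(J eps y1 ** (J eps y0 ** cocycle_iter alpha (J eps) (2 * n) x)) $ i $ j
    = (inverse (u eps y1 ^ d) * (inverse (u eps y0 ^ d) * c)) * inverse (dd i (kap * u eps y1))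
      * (\<Sum>m\<in>UNIV. poly (G i m) (u eps y1) * h m j) * dd j (u eps x)" for i j
    by (rule J_mult_entry[OF X1])
  have orb: "(\<Sum>m\<in>UNIV. poly (G i m) (u eps y1) * h m j) = scal * poly (orbit_poly (kap\<^sup>2) B (Suc n) i j) (u eps x)" for i j
  proof -
    have "(\<Sum>m\<in>UNIV. poly (G i m) (u eps y1) * h m j)
      = (\<Sum>l\<in>UNIV. (\<Sum>m\<in>UNIV. poly (G i m) (kap * u eps y0) * poly (G m l) (u eps y0)) * g l j)"
      unfolding h_def y1 sum_distrib_left sum_distrib_right by (subst sum.swap) (simp add: mult.assoc)
    also have "\<dots> = (\<Sum>l\<in>UNIV. scal * poly (B i l) (u eps y0) * g l j)"
      using scal_nz by (simp add: B_def poly_sum poly_pcompose mult.commute)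
    also have "\<dots> = scal * poly (orbit_poly (kap\<^sup>2) B (Suc n) i j) (u eps x)"
      by (simp add: poly_sum poly_pcompose g_def y0 sum_distrib_left mult_ac)
    finally show ?thesis .
  qed
  define c' where "c' = inverse (u eps y1 ^ d) * (inverse (u eps y0 ^ d) * c) * scal"
  have "cocycle_iter alpha (J eps) (2 * Suc n) x = J eps y1 ** (J eps y0 ** cocycle_iter alpha (J eps) (2 * n) x)"
    by (simp add: y0_def y1_def)
  note two_steps = this
  have end_point: "kap * u eps y1 = (kap\<^sup>2) ^ Suc n * u eps x"
    by (simp add: y1 y0 power2_eq_square mult_ac)
  have "cocycle_iter alpha (J eps) (2 * Suc n) x $ i $ j
    = c' * inverse (dd i ((kap\<^sup>2) ^ Suc n * u eps x)) * poly (orbit_poly (kap\<^sup>2) B (Suc n) i j) (u eps x) * dd j (u eps x)" for i j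
    unfolding two_steps X2 orb end_point c'_def by (simp only: mult_ac)
  moreover have "cmod c' = exp (real (Suc n) * (2 * rate eps))"
  proof -
    have "cmod c' = exp (pi * eps * real d) * exp (pi * eps * real d) * exp (real n * (2 * rate eps)) * (cmod (mu N1) * cmod (mu N2))"
      by (simp add: c'_def norm_mult norm_inverse norm_power cmod_u c(1) cmod_scal exp_minus
          flip: exp_of_nat_mult power_inverse) (simp add: mult_ac exp_minus[symmetric])
    also have "cmod (mu N1) * cmod (mu N2) = exp (ln (cmod (mu N1)) + ln (cmod (mu N2)))"
      using mu1 mu2 by (simp add: exp_add)
    also have "real d = of_int (N2 - N1)" using N12 by (simp add: d_def)
    finally show ?thesis by (simp add: rate_def exp_add[symmetric] algebra_simps)
  qed
  ultimately show ?case by blast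
qed

text \<open>For large \<open>eps\<close> the variable \<open>u\<close> lies in the disc where the
  orbit polynomials are bounded along arbitrarily large \<open>n\<close>. Apart from the scalar
  factor, only constants independent of \<open>n\<close> remain, and these do not affect the
  exponent.\<close>

lemma lyap_eventually:
  obtains eps0 where "eps0 \<ge> 0" "\<And>eps. eps \<ge> eps0 \<Longrightarrow> lyap alpha (J eps) = rate eps"
proof -
  obtain rho where rho: "rho > 0" and orb:
    "\<And>n0. \<exists>n>n0. \<forall>i j k. cmod (coeff (orbit_poly (kap\<^sup>2) B n i j) k) * rho ^ k \<le> (1/2) ^ k"
    using orbit_poly_subexponential[of alpha B, OF irr coeff_B_0, folded kap_sq] by blast
  \<comment> \<open>At \<open>eps = - ln rho / pi\<close> the modulus
    \<open>exp (- pi * eps)\<close> of \<open>u\<close> equals \<open>rho\<close>.\<close>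
  define eps0 where "eps0 = max 0 (- ln rho / pi)"
  have "lyap alpha (J eps) = rate eps" if eps: "eps \<ge> eps0" for eps
  proof (rule antisym)
    show "rate eps \<le> lyap alpha (J eps)" by (rule lyap_ge)
    show "lyap alpha (J eps) \<le> rate eps"
    proof (rule field_le_epsilon)
      fix e :: real assume e: "e > 0"
      have "- pi * eps \<le> ln rho" using eps by (simp add: eps0_def field_simps)
      then have "exp (- pi * eps) \<le> exp (ln rho)" by (rule exp_le_cancel_iff[THEN iffD2])
      then have u_rho: "cmod (u eps x) \<le> rho" for x using rho by (simp add: cmod_u)
      define t where "t = exp (- pi * eps) powi (N1 + N2)"
      have t: "t > 0" by (simp add: t_def)
      \<comment> \<open>\<open>K\<close> dominates the ratios 1, \<open>t\<close> and
        \<open>1 / t\<close> of the end conjugators.\<close>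
      define K where "K = 1 + t + inverse t"
      have K: "K \<ge> 1" using t by (simp add: K_def)
      \<comment> \<open>The 8 is 2 for the polynomial bound times 4 for passing from entries to the
        norm; \<open>n0\<close> lets the slack \<open>e\<close> over \<open>2 * n\<close> steps
        absorb it.\<close>
      obtain n0 :: nat where n0: "ln (8 * K) / (2 * e) < real n0" using reals_Archimedean2 by blast
      obtain n where n: "n > n0" and
        coeffs: "\<And>i j k. cmod (coeff (orbit_poly (kap\<^sup>2) B n i j) k) * rho ^ k \<le> (1/2) ^ k"
        using orb by blast
      have "ln (8 * K) / (2 * e) < real n" using n0 n by linarith
      then have "ln (8 * K) \<le> 2 * e * real n" using e by (simp add: pos_divide_less_eq mult_ac)
      then have "exp (ln (8 * K)) \<le> exp (2 * e * real n)" by simp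
      then have K_le: "8 * K \<le> exp (2 * e * real n)" using K by simp
      have "opnorm (cocycle_iter alpha (J eps) (2 * n) x) \<le> exp (real (2 * n) * (rate eps + e))" for x
      proof -
        obtain c where c: "cmod c = exp (real n * (2 * rate eps))"
          "\<And>i j. cocycle_iter alpha (J eps) (2 * n) x $ i $ j
            = c * inverse (dd i ((kap\<^sup>2) ^ n * u eps x)) * poly (orbit_poly (kap\<^sup>2) B n i j) (u eps x) * dd j (u eps x)"
          using cocycle_entry by blast
        have dd_norm: "cmod (dd i ((kap\<^sup>2) ^ m * u eps x)) = (if i = 1 then t else 1)" for i m
          by (simp add: dd_def norm_power_int norm_mult norm_power kap_def cmod_u t_def)
        have "cmod (cocycle_iter alpha (J eps) (2 * n) x $ i $ j) \<le> exp (real n * (2 * rate eps)) * (2 * K)" for i j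
        proof -
          have "cmod (cocycle_iter alpha (J eps) (2 * n) x $ i $ j)
            = exp (real n * (2 * rate eps)) * (cmod (poly (orbit_poly (kap\<^sup>2) B n i j) (u eps x))
              * (inverse (if i = 1 then t else 1) * (if j = 1 then t else 1)))"
            using dd_norm[of i n] dd_norm[of j 0] by (simp add: c norm_mult norm_inverse)
          also have "\<dots> \<le> exp (real n * (2 * rate eps)) * (2 * K)"
          proof (intro mult_left_mono mult_mono)
            show "cmod (poly (orbit_poly (kap\<^sup>2) B n i j) (u eps x)) \<le> 2"
              by (rule poly_bound_of_coeff_bound[OF coeffs u_rho])
            show "inverse (if i = 1 then t else 1) * (if j = 1 then t else 1) \<le> K"
              using t by (auto simp: K_def)
          qed (use t in auto)
          finally show ?thesis .
        qed
        then have "opnorm (cocycle_iter alpha (J eps) (2 * n) x) \<le> 4 * (exp (real n * (2 * rate eps)) * (2 * K))"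
          by (rule opnorm_le_entries)
        also have "\<dots> = exp (real n * (2 * rate eps)) * (8 * K)" by simp
        also have "\<dots> \<le> exp (real n * (2 * rate eps)) * exp (2 * e * real n)"
          by (intro mult_left_mono K_le) auto
        also have "\<dots> = exp (real (2 * n) * (rate eps + e))"
          by (simp add: exp_add[symmetric] algebra_simps)
        finally show ?thesis .
      qed
      then show "lyap alpha (J eps) \<le> rate eps + e"
        using n by (intro lyap_le[of "2 * n"]) auto
    qed
  qed
  then show ?thesis by (intro that[of eps0]) (auto simp: eps0_def)
qed

end

section \<open>Reflection of the phase and conclusion\<close>

lemma lyap_reflect:
  assumes per: "\<And>x. A (x + 1) = A x" and refl: "\<And>x. A' (- x) = A x"
  shows "lyap (- alpha) A' = lyap alpha A"
proof -
  \<comment> \<open>The orbit of \<open>- x\<close> under rotation by \<open>- alpha\<close> mirrors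
    that of \<open>x\<close> under rotation by \<open>alpha\<close>.\<close>
  have it: "cocycle_iter (- alpha) A' n (- x) = cocycle_iter alpha A n x" for n x
  proof (induction n)
    case (Suc n)
    have "A' (- x + real n * - alpha) = A (x + real n * alpha)"
      using refl[of "x + real n * alpha"] by simp
    then show ?case using Suc by simp
  qed simp
  have per': "A' (x + 1) = A' x" for x
    using refl[of "- x"] refl[of "- x - 1"] per[of "- x - 1"] by (simp add: algebra_simps)
  have "(LBINT x:{0..1}. ln (opnorm (cocycle_iter (- alpha) A' n x)))
    = (LBINT x:{0..1}. ln (opnorm (cocycle_iter alpha A n x)))" for n
    unfolding it[symmetric]
    by (rule set_integral_periodic_reflect[symmetric]) (simp add: cocycle_iter_periodic[where A = A', OF per'])
  then show ?thesis by (simp add: lyap_def)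
qed

text \<open>Reversing all frequencies undoes the sign of the complex phase. The extreme orders
  become \<open>- N2\<close> and \<open>- N1\<close>, so their difference and the pair of extreme
  coefficients are preserved.\<close>

lemma jacobi_cocycle_reflect:
  "jacobi_cocycle M (\<lambda>j. lam (- j)) (- N2) (- N1) (\<lambda>k. mu (- k)) (- alpha) E (- eps) (- x)
    = jacobi_cocycle M lam N1 N2 mu alpha E eps x"
proof -
  have z: "Complex (- x) (- eps) = - Complex x eps" by (simp add: complex_eq_iff)
  have v: "trig_v M (\<lambda>j. lam (- j)) (- w) = trig_v M lam w" for w
    unfolding trig_v_def
    by (rule sum.reindex_bij_witness[of _ uminus uminus]) auto
  have c: "trig_c (- N2) (- N1) (\<lambda>k. mu (- k)) (- w) = trig_c N1 N2 mu w" for w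
    unfolding trig_c_def
    by (rule sum.reindex_bij_witness[of _ uminus uminus]) auto
  have ct: "trig_ct (- N2) (- N1) (\<lambda>k. mu (- k)) (- w) = trig_ct N1 N2 mu w" for w
    unfolding trig_ct_def
    by (rule sum.reindex_bij_witness[of _ uminus uminus]) auto
  show ?thesis
    using ct[of "Complex x eps - complex_of_real alpha"]
    by (simp add: jacobi_cocycle_def z v c)
qed

theorem mainTheorem9:
  fixes alpha :: real and M :: nat and lam :: "int \<Rightarrow> complex"
    and N1 N2 :: int and mu :: "int \<Rightarrow> complex"
  assumes irr: "alpha \<notin> \<rat>"
    and sym: "\<And>j. 1 \<le> \<bar>j\<bar> \<Longrightarrow> \<bar>j\<bar> \<le> int M \<Longrightarrow> lam (- j) = cnj (lam j)"
    and N12: "N1 < N2"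
    and mu1: "mu N1 \<noteq> 0" and mu2: "mu N2 \<noteq> 0"
    and gap: "N2 - N1 > 2 * int M"
  shows "\<forall>E::real.
     (\<exists>eps0\<ge>0. \<forall>eps::real. \<bar>eps\<bar> \<ge> eps0 \<longrightarrow>
        lyap alpha (jacobi_cocycle M lam N1 N2 mu alpha E eps)
          = pi * real_of_int (N2 - N1) * \<bar>eps\<bar> + (ln (cmod (mu N1)) + ln (cmod (mu N2))) / 2)
   \<and> lyap alpha (jacobi_cocycle M lam N1 N2 mu alpha E 0) - Ic N1 N2 mu
        \<ge> (ln (cmod (mu N1)) + ln (cmod (mu N2))) / 2 - Ic N1 N2 mu"
proof (intro allI conjI)
  fix E :: real
  interpret pos: jacobi alpha M lam N1 N2 mu E
    using irr N12 mu1 mu2 gap by unfold_locales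
  \<comment> \<open>Negative \<open>eps\<close> for the given data is positive \<open>- eps\<close>
    for the reflected data, and \<open>neg.rate (- eps)\<close> is the asserted value.\<close>
  interpret neg: jacobi "- alpha" M "\<lambda>j. lam (- j)" "- N2" "- N1" "\<lambda>k. mu (- k)" E
    using irr N12 mu1 mu2 gap by unfold_locales auto
  obtain e1 where e1: "e1 \<ge> 0" "\<And>eps. eps \<ge> e1 \<Longrightarrow> lyap alpha (jacobi_cocycle M lam N1 N2 mu alpha E eps) = pos.rate eps"
    using pos.lyap_eventually by blast
  obtain e2 where e2: "e2 \<ge> 0" "\<And>eps. eps \<ge> e2 \<Longrightarrow>
      lyap (- alpha) (jacobi_cocycle M (\<lambda>j. lam (- j)) (- N2) (- N1) (\<lambda>k. mu (- k)) (- alpha) E eps) = neg.rate eps"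
    using neg.lyap_eventually by blast
  show "\<exists>eps0\<ge>0. \<forall>eps::real. \<bar>eps\<bar> \<ge> eps0 \<longrightarrow>
      lyap alpha (jacobi_cocycle M lam N1 N2 mu alpha E eps)
        = pi * real_of_int (N2 - N1) * \<bar>eps\<bar> + (ln (cmod (mu N1)) + ln (cmod (mu N2))) / 2"
  proof (intro exI[of _ "max e1 e2"] conjI allI impI)
    show "0 \<le> max e1 e2" using e1(1) by simp
    fix eps :: real assume eps: "max e1 e2 \<le> \<bar>eps\<bar>"
    show "lyap alpha (jacobi_cocycle M lam N1 N2 mu alpha E eps)
        = pi * real_of_int (N2 - N1) * \<bar>eps\<bar> + (ln (cmod (mu N1)) + ln (cmod (mu N2))) / 2"
    proof (cases "eps \<ge> 0")
      case True
      then show ?thesis using e1(2)[of eps] eps by (simp add: pos.rate_def)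
    next
      case False
      have "lyap alpha (jacobi_cocycle M lam N1 N2 mu alpha E eps)
        = lyap (- alpha) (jacobi_cocycle M (\<lambda>j. lam (- j)) (- N2) (- N1) (\<lambda>k. mu (- k)) (- alpha) E (- eps))"
        by (rule lyap_reflect[symmetric]) (rule pos.J_periodic, rule jacobi_cocycle_reflect)
      also have "\<dots> = neg.rate (- eps)" using False eps by (intro e2(2)) auto
      finally show ?thesis using False by (simp add: neg.rate_def)
    qed
  qed
  show "(ln (cmod (mu N1)) + ln (cmod (mu N2))) / 2 - Ic N1 N2 mu
      \<le> lyap alpha (jacobi_cocycle M lam N1 N2 mu alpha E 0) - Ic N1 N2 mu"
    using pos.lyap_ge[of 0] by (simp add: pos.rate_def)
qed

end
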